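(* Let $A$, $\mathcal H$, $\mathcal H_+$, the boundary triplet $(\Gamma_0,\Gamma_1,\mathfrak H)$ with $\mathrm T=[\Gamma_0,\Gamma_1]^\top$, $J$, $Q_t$, $\mathcal A_t$, $t_0\in[0,1]$, the isolated eigenvalue $\lambda$ of $\mathcal A_{t_0}$ of finite multiplicity $m$, the reduced resolvent $S_{t_0}$ of $\mathcal A_{t_0}$ at $\lambda$, the eigenvalue curves $\lambda_{i,k}(t)$ bifurcating from $\lambda$ and the orthonormal eigenvectors $u_{i,k}$ ($k=1,\dots,m_i'$, $i=1,\dots,m'$) be as in the context. Assume that $\operatorname{ran}(Q_t)=\ker[\Theta_t,-I]$ with $\Theta_t=\Theta_t^*\in\mathcal B(\mathfrak H)$, that is, $\mathcal A_t$ is the Robin-type self-adjoint extension of $A$ with $$\operatorname{dom}(\mathcal A_t)=\{u\in\mathcal H_+:\ \Gamma_1u=\Theta_t\Gamma_0u\},$$ and that, as $t\to t_0$, $\Theta_t=\Theta_{t_0}+\dot\Theta_{t_0}(t-t_0)+\frac12\ddot\Theta_{t_0}(t-t_0)^2+o((t-t_0)^2)$ in $\mathcal B(\mathfrak H)$. Then, as $t\to t_0$, $$\begin{aligned}\lambda_{i,k}(t)=\lambda&+\langle\dot\Theta_{t_0}\Gamma_0u_{i,k},\Gamma_0u_{i,k}\rangle_{\mathfrak H}(t-t_0)\\&+\tfrac12\Big\langle\big(\ddot\Theta_{t_0}-2\dot\Theta_{t_0}\Gamma_0(\Gamma_0S_{t_0})^*\dot\Theta_{t_0}\big)\Gamma_0u_{i,k},\Gamma_0u_{i,k}\Big\rangle_{\mathfrak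 H}(t-t_0)^2+o((t-t_0)^2).\end{aligned}$$
   Context: Inner products are linear in the first argument. $\mathcal H$, $\mathfrak H$ are complex Hilbert spaces. $A$ is a densely defined symmetric operator in $\mathcal H$ with equal (possibly infinite) deficiency indices. $\mathcal H_+:=\operatorname{dom}(A^* )$ is equipped with the graph scalar product $\langle u,v\rangle_{\mathcal H_+}=\langle u,v\rangle_{\mathcal H}+\langle A^*u,A^*v\rangle_{\mathcal H}$. Boundary triplet: $\mathrm T:=[\Gamma_0,\Gamma_1]^\top\in\mathcal B(\mathcal H_+,\mathfrak H\times\mathfrak H)$ is bounded, surjective, and satisfies $\langle A^*u,v\rangle_{\mathcal H}-\langle u,A^*v\rangle_{\mathcal H}=\langle\Gamma_1u,\Gamma_0v\rangle_{\mathfrak H}-\langle\Gamma_0u,\Gamma_1v\rangle_{\mathfrak H}$ for all $u,v\in\mathcal H_+$. Symplectic form on $\mathfrak H\times\mathfrak H$: $\omega((f_1,f_2)^\top,(g_1,g_2)^\top)=\langle f_2,g_1\rangle_{\mathfrak H}-\langle f_1,g_2\rangle_{\mathfrak H}=\langle J(f_1,f_2)^\top,(g_1,g_2)^\top\rangle_{\mathfrak H\times\mathfrak H}$, with $J=\begin{bmatrix}0&I_{\mathfrak H}\\-I_{\mathfrak H}&0\end{bmatrix}$. A subspace $\mathcal F\subset\mathfrak H\times\mathfrak H$ is Lagrangian if it equals its $\omega$-annihilator $\{f:\omega(f,g)=0\ \forall g\in\mathcal F\}$. For every Lagrangian $\mathcal F$, the restriction of $A^*$ to $\mathrm T^{-1}(\mathcal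 F)$ is a self-adjoint extension of $A$, and all self-adjoint extensions arise this way. Family: for $t\in[0,1]$, $Q_t\in\mathcal B(\mathfrak H\times\mathfrak H)$ is an orthogonal projection whose range is Lagrangian; $t_0\in[0,1]$ is fixed and, as $t\to t_0$ (in $[0,1]$), $Q_t=Q_{t_0}+\dot Q_{t_0}(t-t_0)+\frac12\ddot Q_{t_0}(t-t_0)^2+o((t-t_0)^2)$ in $\mathcal B(\mathfrak H\times\mathfrak H)$ with $\dot Q_{t_0},\ddot Q_{t_0}\in\mathcal B(\mathfrak H\times\mathfrak H)$. $\mathcal A_t$ is the self-adjoint extension of $A$ with $\mathrm T(\operatorname{dom}(\mathcal A_t))=\operatorname{ran}(Q_t)$, and $R_t(\zeta):=(\mathcal A_t-\zeta)^{-1}$ for $\zeta\notin\operatorname{Spec}(\mathcal A_t)$. The operator $[\Theta_t,-I]$ acts by $(u,v)^\top\mapsto\Theta_tu-v$. Spectral objects: $\lambda$ is an isolated eigenvalue of $\mathcal A_{t_0}$ of finite multiplicity $m$; $\gamma:=\{z\in\mathbb C:2|z-\lambda|=\operatorname{dist}(\lambda,\operatorname{Spec}(\mathcal A_{t_0})\setminus\{\lambda\})\}$, oriented counterclockwise. For $t$ sufficiently close to $t_0$, $\gamma\cap\operatorname{Spec}(\mathcal A_t)=\emptyset$ and $\gamma$ encloses $m$ eigenvalues (counted with multiplicity) of $\mathcal A_t$; $P_t:=\frac{-1}{2\pi\mathbf i}\int_\gamma R_t(\zeta)\,d\zeta$ is the Riesz projection. The reduced resolvent is $S_{t_0}:=\frac{-1}{2\pi\mathbf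 i}\int_\gamma(\lambda-\zeta)^{-1}R_{t_0}(\zeta)\,d\zeta=\lim_{\zeta\to\lambda}R_{t_0}(\zeta)(I_{\mathcal H}-P_{t_0})$. With $D_t:=P_t-P_{t_0}$ and $t$ near $t_0$, $U_t:=(I-D_t^2)^{-1/2}\big((I-P_t)(I-P_{t_0})+P_tP_{t_0}\big)$, with inverse $U_t^{-1}=\big((I-P_{t_0})(I-P_t)+P_{t_0}P_t\big)(I-D_t^2)^{-1/2}$, maps $\operatorname{ran}(P_{t_0})$ unitarily onto $\operatorname{ran}(P_t)$, and $W_t:=P_{t_0}U_t^{-1}\mathcal A_tU_tP_{t_0}$, regarded as an operator in the $m$-dimensional space $\operatorname{ran}(P_{t_0})$; $\operatorname{Spec}(W_t)=\operatorname{Spec}(\mathcal A_tP_t|_{\operatorname{ran}(P_t)})$. Put $\dot W_{t_0}:=(\mathrm TP_{t_0})^*J\dot Q_{t_0}\mathrm TP_{t_0}$, $\ddot W_{t_0}:=(\mathrm TP_{t_0})^*J\ddot Q_{t_0}\mathrm TP_{t_0}-2\big(\mathrm T(\mathrm TS_{t_0})^*\dot Q_{t_0}J\mathrm TP_{t_0}\big)^*\dot Q_{t_0}J\mathrm TP_{t_0}$. Eigenvalue curves and eigenvectors: $\mu_1,\dots,\mu_{m'}$ ($m'\le m$) are the distinct eigenvalues of $\dot W_{t_0}$ in $\operatorname{ran}(P_{t_0})$, with eigenprojections $P^{(i)}_{t_0}$; $\nu_{i,1},\dots,\nu_{i,m_i'}$ are the distinct eigenvalues of $P^{(i)}_{t_0}\ddot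 W_{t_0}P^{(i)}_{t_0}$ in $\operatorname{ran}(P^{(i)}_{t_0})$. The curves $t\mapsto\lambda_{i,k}(t)$, defined for $t$ near $t_0$, satisfy $\lambda_{i,k}(t)\in\operatorname{Spec}(W_t)$ and $\lambda_{i,k}(t)=\lambda+\mu_i(t-t_0)+\frac12\nu_{i,k}(t-t_0)^2+o((t-t_0)^2)$ (such a labeling exists). The $u_{i,k}\in\operatorname{ran}(P^{(i)}_{t_0})$ form an orthonormal set, with $u_{i,k}$ an eigenvector of $P^{(i)}_{t_0}\ddot W_{t_0}P^{(i)}_{t_0}$ for the eigenvalue $\nu_{i,k}$ (hence also an eigenvector of $\dot W_{t_0}$ for $\mu_i$ and of $\mathcal A_{t_0}$ for $\lambda$). Conventions: $P_{t_0},S_{t_0}\in\mathcal B(\mathcal H,\mathcal H_+)$, so $\mathrm TP_{t_0},\mathrm TS_{t_0}\in\mathcal B(\mathcal H,\mathfrak H\times\mathfrak H)$ and $\Gamma_0S_{t_0}\in\mathcal B(\mathcal H,\mathfrak H)$; $(\cdot)^*$ denotes the adjoints of these operators, e.g. $(\Gamma_0S_{t_0})^*\in\mathcal B(\mathfrak H,\mathcal H)$. The operator $(\mathrm TS_{t_0})^*\dot Q_{t_0}J\mathrm TP_{t_0}$ and the operator $(\Gamma_0S_{t_0})^*$ have ranges in $\mathcal H_+$, so applying $\mathrm T$, respectively $\Gamma_0$, to them is meaningful. *)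

theory Defs
  imports "HOL-Complex_Analysis.Complex_Analysis"
begin

section \<open>Complex Hilbert spaces\<close>

class scaleC = scaleR +
  fixes scaleC :: "complex \<Rightarrow> 'a \<Rightarrow> 'a"  (infixr "*\<^sub>C" 75)

text \<open>The inner product is linear in the \<^emph>\<open>first\<close> argument.\<close>

class complex_hilbert = banach + scaleC +
  fixes cinner :: "'a \<Rightarrow> 'a \<Rightarrow> complex"
  assumes scaleC_add_right: "c *\<^sub>C (x + y) = c *\<^sub>C x + c *\<^sub>C y"
    and scaleC_add_left: "(c + d) *\<^sub>C x = c *\<^sub>C x + d *\<^sub>C x"
    and scaleC_scaleC: "c *\<^sub>C (d *\<^sub>C x) = (c * d) *\<^sub>C x"
    and scaleR_scaleC: "r *\<^sub>R x = complex_of_real r *\<^sub>C x"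
    and cinner_add_left: "cinner (x + y) z = cinner x z + cinner y z"
    and cinner_scaleC_left: "cinner (c *\<^sub>C x) y = c * cinner x y"
    and cinner_commute: "cinner x y = cnj (cinner y x)"
    and cinner_self: "cinner x x = complex_of_real ((norm x)\<^sup>2)"

lemma scaleC_one: "1 *\<^sub>C x = (x :: 'a::complex_hilbert)"
  using scaleR_scaleC[of 1 x] by simp

global_interpretation complex_vector: vector_space "scaleC :: complex \<Rightarrow> 'a \<Rightarrow> 'a::complex_hilbert"
  by unfold_locales (simp_all add: scaleC_add_right scaleC_add_left scaleC_scaleC scaleC_one)

instantiation prod :: (complex_hilbert, complex_hilbert) complex_hilbert
begin

definition scaleC_prod :: "complex \<Rightarrow> 'a \<times> 'b \<Rightarrow> 'a \<times> 'b" where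
  "scaleC_prod c x = (c *\<^sub>C fst x, c *\<^sub>C snd x)"

definition cinner_prod :: "'a \<times> 'b \<Rightarrow> 'a \<times> 'b \<Rightarrow> complex" where
  "cinner_prod x y = cinner (fst x) (fst y) + cinner (snd x) (snd y)"

instance
proof
  fix x y z :: "'a \<times> 'b" and c d :: complex and r :: real
  show "c *\<^sub>C (x + y) = c *\<^sub>C x + c *\<^sub>C y"
    by (simp add: scaleC_prod_def scaleC_add_right)
  show "(c + d) *\<^sub>C x = c *\<^sub>C x + d *\<^sub>C x"
    by (simp add: scaleC_prod_def scaleC_add_left)
  show "c *\<^sub>C (d *\<^sub>C x) = (c * d) *\<^sub>C x"
    by (simp add: scaleC_prod_def scaleC_scaleC)
  show "r *\<^sub>R x = complex_of_real r *\<^sub>C x"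
    by (simp add: scaleC_prod_def scaleR_prod_def scaleR_scaleC)
  show "cinner (x + y) z = cinner x z + cinner y z"
    by (simp add: cinner_prod_def cinner_add_left)
  show "cinner (c *\<^sub>C x) y = c * cinner x y"
    by (simp add: cinner_prod_def scaleC_prod_def cinner_scaleC_left algebra_simps)
  show "cinner x y = cnj (cinner y x)"
    by (simp add: cinner_prod_def) (metis cinner_commute)
  show "cinner x x = complex_of_real ((norm x)\<^sup>2)"
    by (simp add: cinner_prod_def norm_prod_def cinner_self)
qed

end

section \<open>Bounded operators\<close>

definition bounded_clinear :: "('a::complex_hilbert \<Rightarrow> 'b::complex_hilbert) \<Rightarrow> bool" where
  "bounded_clinear f \<longleftrightarrow> bounded_linear f \<and> (\<forall>c x. f (c *\<^sub>C x) = c *\<^sub>C f x)"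

definition cadjoint :: "('a::complex_hilbert \<Rightarrow> 'b::complex_hilbert) \<Rightarrow> 'b \<Rightarrow> 'a" where
  "cadjoint f = (THE g. \<forall>x y. cinner (f x) y = cinner x (g y))"

definition orthogonal_projection :: "('a::complex_hilbert \<Rightarrow> 'a) \<Rightarrow> bool" where
  "orthogonal_projection P \<longleftrightarrow> bounded_clinear P \<and> P \<circ> P = P \<and> cadjoint P = P"

definition positive_op :: "('a::complex_hilbert \<Rightarrow> 'a) \<Rightarrow> bool" where
  "positive_op X \<longleftrightarrow> bounded_clinear X \<and> (\<forall>x. cinner (X x) x \<in> \<real>\<^sub>\<ge>\<^sub>0)"

text \<open>\<open>X\<^sup>-\<^sup>1\<^sup>/\<^sup>2\<close>: the unique positive square root of the inverse of a
  positive, boundedly invertible operator \<open>X\<close>.\<close>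

definition inv_sqrt_op :: "('a::complex_hilbert \<Rightarrow> 'a) \<Rightarrow> 'a \<Rightarrow> 'a" where
  "inv_sqrt_op X = (THE Y. positive_op Y \<and> X \<circ> (Y \<circ> Y) = id \<and> (Y \<circ> Y) \<circ> X = id)"

definition proj_onto :: "'a::complex_hilbert set \<Rightarrow> 'a \<Rightarrow> 'a" where
  "proj_onto M x = (THE y. y \<in> M \<and> (\<forall>z\<in>M. cinner (x - y) z = 0))"

text \<open>\<open>F t = F t0 + (t - t0) F1 + 1/2 (t - t0)\<^sup>2 F2 + o((t - t0)\<^sup>2)\<close> in operator norm,
  as \<open>t \<rightarrow> t0\<close> in \<open>[0,1]\<close>.\<close>

definition expansion2 ::
  "(real \<Rightarrow> 'a::complex_hilbert \<Rightarrow> 'b::complex_hilbert) \<Rightarrow> ('a \<Rightarrow> 'b) \<Rightarrow> ('a \<Rightarrow> 'b) \<Rightarrow> real \<Rightarrow> bool" where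
  "expansion2 F F1 F2 t0 \<longleftrightarrow>
     (\<lambda>t. onorm (\<lambda>x. F t x - (F t0 x + (t - t0) *\<^sub>R F1 x + ((t - t0)\<^sup>2 / 2) *\<^sub>R F2 x)))
       \<in> o[at t0 within {0..1}](\<lambda>t. (t - t0)\<^sup>2)"

section \<open>Unbounded operators\<close>

text \<open>Unbounded operators are represented by their graphs: \<open>(u, w) \<in> G\<close> means that \<open>u\<close> lies in the
  domain and is mapped to \<open>w\<close>.\<close>

definition linear_op :: "('h::complex_hilbert \<times> 'h) set \<Rightarrow> bool" where
  "linear_op G \<longleftrightarrow> complex_vector.subspace G \<and> single_valued G"

definition densely_defined :: "('h::complex_hilbert \<times> 'h) set \<Rightarrow> bool" where
  "densely_defined G \<longleftrightarrow> closure (Domain G) = UNIV"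

definition adjoint_op :: "('h::complex_hilbert \<times> 'h) set \<Rightarrow> ('h \<times> 'h) set" where
  "adjoint_op G = {(v, w). \<forall>(x, y)\<in>G. cinner y v = cinner x w}"

definition symmetric_op :: "('h::complex_hilbert \<times> 'h) set \<Rightarrow> bool" where
  "symmetric_op G \<longleftrightarrow> G \<subseteq> adjoint_op G"

definition op_apply :: "('h::complex_hilbert \<times> 'h) set \<Rightarrow> 'h \<Rightarrow> 'h" where
  "op_apply G u = (THE w. (u, w) \<in> G)"

definition eigenspace :: "('h::complex_hilbert \<times> 'h) set \<Rightarrow> complex \<Rightarrow> 'h set" where
  "eigenspace G z = {u. (u, z *\<^sub>C u) \<in> G}"

definition resolvent :: "('h::complex_hilbert \<times> 'h) set \<Rightarrow> complex \<Rightarrow> 'h \<Rightarrow> 'h" where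
  "resolvent G z f = (THE u. (u, f + z *\<^sub>C u) \<in> G)"

definition spectrum :: "('h::complex_hilbert \<times> 'h) set \<Rightarrow> complex set" where
  "spectrum G = - {z. (\<forall>f. \<exists>!u. (u, f + z *\<^sub>C u) \<in> G) \<and> bounded_clinear (resolvent G z)}"

definition orthonormal_basis :: "'h::complex_hilbert set \<Rightarrow> 'h set \<Rightarrow> bool" where
  "orthonormal_basis B M \<longleftrightarrow>
     (\<forall>x\<in>B. \<forall>y\<in>B. cinner x y = (if x = y then 1 else 0)) \<and> closure (complex_vector.span B) = M"

text \<open>The deficiency indices are the (possibly infinite) Hilbert dimensions of
  \<open>ker (A\<^sup>* - \<i>)\<close> and \<open>ker (A\<^sup>* + \<i>)\<close>.\<close>

definition equal_deficiency_indices :: "('h::complex_hilbert \<times> 'h) set \<Rightarrow> bool" where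
  "equal_deficiency_indices A \<longleftrightarrow>
     (\<exists>B C. orthonormal_basis B (eigenspace (adjoint_op A) \<i>) \<and>
            orthonormal_basis C (eigenspace (adjoint_op A) (- \<i>)) \<and> B \<approx> C)"

section \<open>Boundary triplets and Lagrangian subspaces\<close>

definition graph_cinner :: "('h::complex_hilbert \<times> 'h) set \<Rightarrow> 'h \<Rightarrow> 'h \<Rightarrow> complex" where
  "graph_cinner A u v =
     cinner u v + cinner (op_apply (adjoint_op A) u) (op_apply (adjoint_op A) v)"

definition trace_map :: "('h \<Rightarrow> 'k) \<Rightarrow> ('h \<Rightarrow> 'k) \<Rightarrow> 'h \<Rightarrow> 'k \<times> 'k" where
  "trace_map \<Gamma>0 \<Gamma>1 u = (\<Gamma>0 u, \<Gamma>1 u)"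

text \<open>\<open>\<Gamma>0\<close> and \<open>\<Gamma>1\<close> are total functions, but only their restrictions to \<open>H\<^sub>+ = dom(A\<^sup>*)\<close>
  are constrained or used.\<close>

definition boundary_triplet ::
  "('h::complex_hilbert \<times> 'h) set \<Rightarrow> ('h \<Rightarrow> 'k::complex_hilbert) \<Rightarrow> ('h \<Rightarrow> 'k) \<Rightarrow> bool" where
  "boundary_triplet A \<Gamma>0 \<Gamma>1 \<longleftrightarrow>
     (let Hp = Domain (adjoint_op A); As = op_apply (adjoint_op A); T = trace_map \<Gamma>0 \<Gamma>1 in
       (\<forall>u\<in>Hp. \<forall>v\<in>Hp. T (u + v) = T u + T v) \<and>
       (\<forall>c. \<forall>u\<in>Hp. T (c *\<^sub>C u) = c *\<^sub>C T u) \<and>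
       (\<exists>K. \<forall>u\<in>Hp. norm (T u) \<le> K * sqrt (Re (graph_cinner A u u))) \<and>
       T ` Hp = UNIV \<and>
       (\<forall>u\<in>Hp. \<forall>v\<in>Hp. cinner (As u) v - cinner u (As v)
          = cinner (\<Gamma>1 u) (\<Gamma>0 v) - cinner (\<Gamma>0 u) (\<Gamma>1 v)))"

definition Jop :: "'k::complex_hilbert \<times> 'k \<Rightarrow> 'k \<times> 'k" where
  "Jop f = (snd f, - fst f)"

definition symplectic_form :: "'k::complex_hilbert \<times> 'k \<Rightarrow> 'k \<times> 'k \<Rightarrow> complex" where
  "symplectic_form f g = cinner (snd f) (fst g) - cinner (fst f) (snd g)"

definition lagrangian :: "('k::complex_hilbert \<times> 'k) set \<Rightarrow> bool" where
  "lagrangian F \<longleftrightarrow>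
     complex_vector.subspace F \<and> F = {f. \<forall>g\<in>F. symplectic_form f g = 0}"

text \<open>The restriction of \<open>A\<^sup>*\<close> to \<open>T\<^sup>-\<^sup>1(F)\<close>.\<close>

definition extension_of ::
  "('h::complex_hilbert \<times> 'h) set \<Rightarrow> ('h \<Rightarrow> 'k) \<Rightarrow> ('h \<Rightarrow> 'k) \<Rightarrow> ('k \<times> 'k) set \<Rightarrow> ('h \<times> 'h) set" where
  "extension_of A \<Gamma>0 \<Gamma>1 F = {(u, w) \<in> adjoint_op A. trace_map \<Gamma>0 \<Gamma>1 u \<in> F}"

section \<open>Riesz projections and reduced resolvents\<close>

text \<open>The integral is that of a function with values in the Banach space of bounded operators,
  for which we use the real-linear bounded operators of the library.\<close>

definition op_contour_integral ::
  "(real \<Rightarrow> complex) \<Rightarrow> (complex \<Rightarrow> 'h::complex_hilbert \<Rightarrow> 'h) \<Rightarrow> 'h \<Rightarrow> 'h" where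
  "op_contour_integral g F =
     blinfun_apply (integral {0..1}
       (\<lambda>s. Blinfun (\<lambda>x. vector_derivative g (at s within {0..1}) *\<^sub>C F (g s) x)))"

text \<open>Half of \<open>dist(z, Spec(G) - {z})\<close>. The library sets \<open>infdist z {} = 0\<close>; the distance to the
  empty set should be infinite, and then any positive radius will do.\<close>

definition half_gap :: "('h::complex_hilbert \<times> 'h) set \<Rightarrow> complex \<Rightarrow> real" where
  "half_gap G z =
     (if spectrum G - {z} = {} then 1 else infdist z (spectrum G - {z}) / 2)"

section \<open>Operators in a subspace\<close>

definition eigenvalues_in :: "'h::complex_hilbert set \<Rightarrow> ('h \<Rightarrow> 'h) \<Rightarrow> complex set" where
  "eigenvalues_in M X = {z. \<exists>x\<in>M. x \<noteq> 0 \<and> X x = z *\<^sub>C x}"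

text \<open>Used for finite-dimensional invariant subspaces \<open>M\<close> only, where the inverse is
  automatically bounded.\<close>

definition spectrum_in :: "'h::complex_hilbert set \<Rightarrow> ('h \<Rightarrow> 'h) \<Rightarrow> complex set" where
  "spectrum_in M X = {z. \<not> bij_betw (\<lambda>x. X x - z *\<^sub>C x) M M}"

section \<open>The perturbation problem\<close>

text \<open>\<open>Q1\<close> and \<open>Q2\<close> are the first and second derivatives of \<open>Q\<close> at \<open>t0\<close>. As \<open>complex_vector.dim\<close>
  is \<open>0\<close> for infinite-dimensional subspaces, the last two assumptions say that \<open>lam\<close> is an
  eigenvalue of finite multiplicity \<open>m\<close>.\<close>

locale lagrangian_family =
  fixes A :: "('h::complex_hilbert \<times> 'h) set"
    and \<Gamma>0 \<Gamma>1 :: "'h \<Rightarrow> 'k::complex_hilbert"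
    and Q :: "real \<Rightarrow> 'k \<times> 'k \<Rightarrow> 'k \<times> 'k"
    and Q1 Q2 :: "'k \<times> 'k \<Rightarrow> 'k \<times> 'k"
    and t0 :: real and lam :: complex and m :: nat
  assumes A_op: "linear_op A" "densely_defined A" "symmetric_op A"
    and A_deficiency: "equal_deficiency_indices A"
    and triplet: "boundary_triplet A \<Gamma>0 \<Gamma>1"
    and Q_proj: "\<And>t. t \<in> {0..1} \<Longrightarrow> orthogonal_projection (Q t)"
    and Q_lagrangian: "\<And>t. t \<in> {0..1} \<Longrightarrow> lagrangian (range (Q t))"
    and t0: "t0 \<in> {0..1}"
    and Q12_bounded: "bounded_clinear Q1" "bounded_clinear Q2"
    and Q_expansion: "expansion2 Q Q1 Q2 t0"
    and lam_isolated:
      "\<exists>\<epsilon>>0. ball lam \<epsilon> \<inter> spectrum (extension_of A \<Gamma>0 \<Gamma>1 (range (Q t0))) = {lam}"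
    and lam_multiplicity:
      "complex_vector.dim (eigenspace (extension_of A \<Gamma>0 \<Gamma>1 (range (Q t0))) lam) = m"
    and m_pos: "0 < m"
begin

abbreviation T :: "'h \<Rightarrow> 'k \<times> 'k" where
  "T \<equiv> trace_map \<Gamma>0 \<Gamma>1"

definition ext :: "real \<Rightarrow> ('h \<times> 'h) set" where
  "ext t = extension_of A \<Gamma>0 \<Gamma>1 (range (Q t))"

definition contour :: "real \<Rightarrow> complex" where
  "contour = circlepath lam (half_gap (ext t0) lam)"

definition P :: "real \<Rightarrow> 'h \<Rightarrow> 'h" where
  "P t x = (- 1 / (2 * pi * \<i>)) *\<^sub>C op_contour_integral contour (resolvent (ext t)) x"

definition S :: "'h \<Rightarrow> 'h" where
  "S x = (- 1 / (2 * pi * \<i>)) *\<^sub>C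
     op_contour_integral contour (\<lambda>z y. inverse (lam - z) *\<^sub>C resolvent (ext t0) z y) x"

definition D :: "real \<Rightarrow> 'h \<Rightarrow> 'h" where
  "D t x = P t x - P t0 x"

definition U :: "real \<Rightarrow> 'h \<Rightarrow> 'h" where
  "U t x = inv_sqrt_op (\<lambda>y. y - D t (D t y))
     ((x - P t0 x) - P t (x - P t0 x) + P t (P t0 x))"

text \<open>\<open>U t\<close> is invertible on the whole space for \<open>t\<close> near \<open>t0\<close>; \<open>W\<close> is only used for such \<open>t\<close>.\<close>

definition W :: "real \<Rightarrow> 'h \<Rightarrow> 'h" where
  "W t x = P t0 (inv (U t) (op_apply (ext t) (U t (P t0 x))))"

definition Wdot :: "'h \<Rightarrow> 'h" where
  "Wdot x = cadjoint (T \<circ> P t0) (Jop (Q1 (T (P t0 x))))"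

definition Wddot :: "'h \<Rightarrow> 'h" where
  "Wddot x = cadjoint (T \<circ> P t0) (Jop (Q2 (T (P t0 x))))
     - 2 *\<^sub>C cadjoint (\<lambda>y. T (cadjoint (T \<circ> S) (Q1 (Jop (T (P t0 y))))))
               (Q1 (Jop (T (P t0 x))))"

text \<open>\<open>Wdot\<close> is self-adjoint (as \<open>J Q1\<close> is), so its eigenprojections are orthogonal.\<close>

definition eigenproj :: "complex \<Rightarrow> 'h \<Rightarrow> 'h" where
  "eigenproj z = proj_onto {x \<in> range (P t0). Wdot x = z *\<^sub>C x}"

end

text \<open>\<open>curve i k\<close> is the eigenvalue curve \<open>\<lambda>\<^sub>i\<^sub>,\<^sub>k\<close> with coefficients \<open>\<mu> i\<close> and \<open>\<nu> i k\<close>, where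
  \<open>1 \<le> i \<le> m'\<close> and \<open>1 \<le> k \<le> mi i\<close>.\<close>

locale eigenvalue_curves = lagrangian_family A \<Gamma>0 \<Gamma>1 Q Q1 Q2 t0 lam m
  for A :: "('h::complex_hilbert \<times> 'h) set"
    and \<Gamma>0 \<Gamma>1 :: "'h \<Rightarrow> 'k::complex_hilbert"
    and Q :: "real \<Rightarrow> 'k \<times> 'k \<Rightarrow> 'k \<times> 'k"
    and Q1 Q2 :: "'k \<times> 'k \<Rightarrow> 'k \<times> 'k"
    and t0 :: real and lam :: complex and m :: nat +
  fixes m' :: nat and mi :: "nat \<Rightarrow> nat"
    and \<mu> :: "nat \<Rightarrow> complex" and \<nu> :: "nat \<Rightarrow> nat \<Rightarrow> complex"
    and curve :: "nat \<Rightarrow> nat \<Rightarrow> real \<Rightarrow> complex"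
    and u :: "nat \<Rightarrow> nat \<Rightarrow> 'h"
  assumes \<mu>: "bij_betw \<mu> {1..m'} (eigenvalues_in (range (P t0)) Wdot)"
    and \<nu>: "\<And>i. i \<in> {1..m'} \<Longrightarrow>
      bij_betw (\<nu> i) {1..mi i}
        (eigenvalues_in (range (eigenproj (\<mu> i)))
           (eigenproj (\<mu> i) \<circ> Wddot \<circ> eigenproj (\<mu> i)))"
    and curve_spectrum: "\<And>i k. i \<in> {1..m'} \<Longrightarrow> k \<in> {1..mi i} \<Longrightarrow>
      \<exists>\<delta>>0. \<forall>t\<in>{0..1}. \<bar>t - t0\<bar> < \<delta> \<longrightarrow> curve i k t \<in> spectrum_in (range (P t0)) (W t)"
    and curve_expansion: "\<And>i k. i \<in> {1..m'} \<Longrightarrow> k \<in> {1..mi i} \<Longrightarrow>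
      (\<lambda>t. curve i k t - (lam + \<mu> i * of_real (t - t0) + 1/2 * \<nu> i k * of_real ((t - t0)\<^sup>2)))
        \<in> o[at t0 within {0..1}](\<lambda>t. of_real ((t - t0)\<^sup>2))"
    and u_range: "\<And>i k. i \<in> {1..m'} \<Longrightarrow> k \<in> {1..mi i} \<Longrightarrow>
      u i k \<in> range (eigenproj (\<mu> i))"
    and u_orthonormal: "\<And>i k j l.
      i \<in> {1..m'} \<Longrightarrow> k \<in> {1..mi i} \<Longrightarrow> j \<in> {1..m'} \<Longrightarrow> l \<in> {1..mi j} \<Longrightarrow>
      cinner (u i k) (u j l) = (if i = j \<and> k = l then 1 else 0)"
    and u_eigenvector: "\<And>i k. i \<in> {1..m'} \<Longrightarrow> k \<in> {1..mi i} \<Longrightarrow>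
      eigenproj (\<mu> i) (Wddot (eigenproj (\<mu> i) (u i k))) = \<nu> i k *\<^sub>C u i k"

end

theory Submission
  imports Defs
begin

text \<open>
  The expansion of each curve is part of the data, so the content of the theorem is a
  pair of identities for its coefficients: with \<open>a = \<Gamma>0 u\<close> for an eigenvector \<open>u = u i k\<close>, the numbers
  \<open>\<mu> i = \<langle>Wdot u, u\<rangle>\<close> and \<open>\<nu> i k = \<langle>Wddot u, u\<rangle>\<close>, which are expressed through the derivatives \<open>Q1\<close>, \<open>Q2\<close>
  of the projections, have to be rewritten through the derivatives \<open>\<Theta>1\<close>, \<open>\<Theta>2\<close> of the operators whose
  graphs are the ranges of these projections.

  The passage from \<open>Q\<close> to \<open>\<Theta>\<close> rests on differentiating two relations in \<open>t\<close>. The graph relation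
  \<open>snd (Q t f) = \<Theta> t (fst (Q t f))\<close> gives \<open>snd_Q1\<close> and \<open>snd_Q2\<close>, and the relation
  \<open>Q t Jop + Jop Q t = Jop\<close>, which says that the ranges are Lagrangian, gives \<open>Q1_Jop\<close>. They yield the
  first coefficient at once. In the second one they leave the extra term \<open>2 \<langle>\<Theta>1 (fst (Q1 f)), a\<rangle>\<close>,
  where \<open>f = T u\<close>.

  This term is cancelled by a part of the resolvent term of \<open>Wddot\<close>. Let \<open>w = (\<Gamma>0 S)\<^sup>* \<Theta>1 a\<close>, and let
  \<open>B\<close> be the self-adjoint extension at \<open>t0\<close>. From \<open>S (B - lam) = I - P\<close> and Green's formula one finds
  that \<open>w\<close> lies in the domain of \<open>A\<^sup>*\<close>, that its boundary values satisfy \<open>\<Gamma>1 w = \<Theta> \<Gamma>0 w - \<Theta>1 a\<close>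
  (\<open>boundary_value_cadjoint_TS\<close>), and, using \<open>P w = 0\<close>, that \<open>\<langle>\<Gamma>0 w, \<Theta>1 a\<rangle>\<close> is real
  (\<open>cadjoint_TS_isotropic\<close>). The boundary values produce the cancelling term, and the reality turns what
  remains into the form stated in the theorem (\<open>second_coefficient\<close>).

  These facts need a few algebraic properties of \<open>P\<close> and \<open>S\<close>: \<open>(B - lam) S = I - P\<close>, \<open>S (B - lam) = I - P\<close> on the domain of \<open>B\<close>, \<open>(B - lam) P = 0\<close>,
  and \<open>S = 0\<close> on the eigenspace; the symmetry of \<open>P\<close> and \<open>S P = 0\<close> follow from them. They are obtained
  without a spectral theorem. A vector belongs to the domain of a self-adjoint operator as soon as it
  does so weakly, so only the scalar functions \<open>z \<mapsto> \<langle>R(z) x, y\<rangle>\<close> have to be integrated. For these,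
  \<open>(B - lam) P = 0\<close> says that the Laurent coefficient at \<open>(z - lam)\<^sup>-\<^sup>2\<close> vanishes, which follows from
  \<open>\<bar>Im z\<bar> \<parallel>R(z)\<parallel> \<le> 1\<close> (\<open>contour_integral_circlepath_simple_pole\<close>).
\<close>

section \<open>Inner product and norm\<close>

lemma cinner_add_right: "cinner x (y + z) = cinner x y + cinner x (z::'a::complex_hilbert)"
  by (metis cinner_add_left cinner_commute complex_cnj_add)

lemma cinner_scaleC_right: "cinner x (c *\<^sub>C y) = cnj c * cinner x (y::'a::complex_hilbert)"
  by (metis cinner_scaleC_left cinner_commute complex_cnj_mult)

lemma cinner_scaleR_left: "cinner (r *\<^sub>R x) y = r * cinner x (y::'a::complex_hilbert)"
  by (simp add: scaleR_scaleC cinner_scaleC_left)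

lemma cinner_scaleR_right: "cinner x (r *\<^sub>R y) = r * cinner x (y::'a::complex_hilbert)"
  by (simp add: scaleR_scaleC cinner_scaleC_right)

lemma cinner_zero_left [simp]: "cinner 0 (y::'a::complex_hilbert) = 0"
  using cinner_scaleR_left[of 0 y y] by simp

lemma cinner_zero_right [simp]: "cinner (y::'a::complex_hilbert) 0 = 0"
  using cinner_scaleR_right[of y 0 y] by simp

lemma cinner_minus_left: "cinner (- x) y = - cinner x (y::'a::complex_hilbert)"
  using cinner_scaleR_left[of "-1" x y] by simp

lemma cinner_minus_right: "cinner x (- y) = - cinner x (y::'a::complex_hilbert)"
  using cinner_scaleR_right[of x "-1" y] by simp

lemma cinner_diff_left: "cinner (x - z) y = cinner x y - cinner z (y::'a::complex_hilbert)"
  using cinner_add_left[of x "-z" y] by (simp add: cinner_minus_left)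

lemma cinner_diff_right: "cinner x (y - z) = cinner x y - cinner x (z::'a::complex_hilbert)"
  using cinner_add_right[of x y "-z"] by (simp add: cinner_minus_right)

lemmas cinner_simps = cinner_add_left cinner_add_right cinner_scaleC_left cinner_scaleC_right
  cinner_scaleR_left cinner_scaleR_right cinner_minus_left cinner_minus_right
  cinner_diff_left cinner_diff_right

lemma cinner_self_eq_0: "cinner x x = 0 \<longleftrightarrow> x = (0::'a::complex_hilbert)"
  by (simp add: cinner_self)

lemma cinner_ext: "(\<And>y. cinner x y = cinner z y) \<Longrightarrow> x = (z::'a::complex_hilbert)"
  using cinner_self_eq_0[of "x - z"] by (simp add: cinner_diff_left)

lemma cinner_ext_right: "(\<And>y. cinner y x = cinner y z) \<Longrightarrow> x = (z::'a::complex_hilbert)"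
  using cinner_self_eq_0[of "x - z"] by (simp add: cinner_diff_right)

lemma norm_scaleC: "norm (c *\<^sub>C x) = cmod c * norm (x::'a::complex_hilbert)"
proof -
  have "complex_of_real ((norm (c *\<^sub>C x))\<^sup>2) = c * cnj c * complex_of_real ((norm x)\<^sup>2)"
    by (simp only: cinner_self[symmetric] cinner_simps mult.assoc mult.left_commute)
  also have "\<dots> = complex_of_real ((cmod c * norm x)\<^sup>2)"
    by (simp only: complex_norm_square[symmetric] power_mult_distrib of_real_mult)
  finally have "(norm (c *\<^sub>C x))\<^sup>2 = (cmod c * norm x)\<^sup>2"
    using of_real_eq_iff by blast
  then show ?thesis
    by (simp add: power2_eq_iff_nonneg)
qed

lemma norm_diff_square:
  "(norm (x - y))\<^sup>2 = (norm x)\<^sup>2 + (norm y)\<^sup>2 - 2 * Re (cinner x (y::'a::complex_hilbert))"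
proof -
  have "complex_of_real ((norm (x - y))\<^sup>2)
      = complex_of_real ((norm x)\<^sup>2) + complex_of_real ((norm y)\<^sup>2) - (cinner x y + cinner y x)"
    by (simp only: cinner_self[symmetric] cinner_simps) (simp add: algebra_simps)
  moreover have "cinner x y + cinner y x = complex_of_real (2 * Re (cinner x y))"
    using cinner_commute[of y x] complex_add_cnj[of "cinner x y"] by simp
  ultimately have "complex_of_real ((norm (x - y))\<^sup>2)
      = complex_of_real ((norm x)\<^sup>2 + (norm y)\<^sup>2 - 2 * Re (cinner x y))"
    by simp
  then show ?thesis
    using of_real_eq_iff by blast
qed

lemma norm_cinner_le: "cmod (cinner x y) \<le> norm x * norm (y::'a::complex_hilbert)"
proof (cases "y = 0")
  case False
  define c where "c = cinner x y / complex_of_real ((norm y)\<^sup>2)"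
  have "0 \<le> (norm (x - c *\<^sub>C y))\<^sup>2"
    by simp
  also have "\<dots> = (norm x)\<^sup>2 + (cmod c * norm y)\<^sup>2 - 2 * Re (cnj c * cinner x y)"
    by (simp add: norm_diff_square norm_scaleC cinner_scaleC_right)
  also have "cnj c * cinner x y = complex_of_real ((cmod (cinner x y))\<^sup>2 / (norm y)\<^sup>2)"
    using complex_norm_square[of "cinner x y"] by (simp add: c_def mult.commute)
  also have "(cmod c * norm y)\<^sup>2 = (cmod (cinner x y))\<^sup>2 / (norm y)\<^sup>2"
  proof -
    have "cmod c = cmod (cinner x y) / (norm y)\<^sup>2"
      unfolding c_def norm_divide norm_of_real by simp
    then show ?thesis
      using False by (simp add: field_simps power2_eq_square)
  qed
  finally have "(cmod (cinner x y))\<^sup>2 / (norm y)\<^sup>2 \<le> (norm x)\<^sup>2"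
    by simp
  then have "(cmod (cinner x y))\<^sup>2 \<le> (norm x)\<^sup>2 * (norm y)\<^sup>2"
    using False by (simp add: divide_le_eq)
  then have "(cmod (cinner x y))\<^sup>2 \<le> (norm x * norm y)\<^sup>2"
    by (simp add: power_mult_distrib)
  then show ?thesis
    by (rule power2_le_imp_le) simp
qed simp

lemma bounded_linear_cinner_left: "bounded_linear (\<lambda>x. cinner x (y::'a::complex_hilbert))"
  by (rule bounded_linear_intro[where K = "norm y"])
    (simp_all add: cinner_simps scaleR_conv_of_real norm_cinner_le)

lemma bounded_linear_cinner_right: "bounded_linear (\<lambda>y. cinner (x::'a::complex_hilbert) y)"
  by (rule bounded_linear_intro[where K = "norm x"])
    (simp_all add: cinner_simps scaleR_conv_of_real norm_cinner_le mult.commute[of "norm x"]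
      , metis mult.commute norm_cinner_le)

lemma bounded_linear_scaleC: "bounded_linear (\<lambda>x. c *\<^sub>C (x::'a::complex_hilbert))"
  by (rule bounded_linear_intro[where K = "cmod c"])
    (simp_all add: scaleC_add_right scaleR_scaleC scaleC_scaleC norm_scaleC mult.commute)

lemma bounded_clinearI:
  fixes f :: "'a::complex_hilbert \<Rightarrow> 'b::complex_hilbert"
  assumes "\<And>x y. f (x + y) = f x + f y" "\<And>c x. f (c *\<^sub>C x) = c *\<^sub>C f x"
    and "\<And>x. norm (f x) \<le> norm x * K"
  shows "bounded_clinear f"
  unfolding bounded_clinear_def
  by (auto intro!: bounded_linear_intro[where K = K] simp: assms scaleR_scaleC)

lemma bounded_clinear_bounded_linear: "bounded_clinear f \<Longrightarrow> bounded_linear f"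
  by (simp add: bounded_clinear_def)

lemma bounded_clinear_add: "bounded_clinear f \<Longrightarrow> f (x + y) = f x + f y"
  by (simp add: bounded_clinear_def linear_simps)

lemma bounded_clinear_diff: "bounded_clinear f \<Longrightarrow> f (x - y) = f x - f y"
  by (simp add: bounded_clinear_def linear_simps)

lemma bounded_clinear_minus: "bounded_clinear f \<Longrightarrow> f (- x) = - f x"
  by (simp add: bounded_clinear_def linear_simps)

lemma bounded_clinear_zero: "bounded_clinear f \<Longrightarrow> f 0 = 0"
  by (simp add: bounded_clinear_def linear_simps)

lemma bounded_clinear_scaleC: "bounded_clinear f \<Longrightarrow> f (c *\<^sub>C x) = c *\<^sub>C f x"
  by (simp add: bounded_clinear_def)

lemma bounded_clinear_bound:
  assumes "bounded_clinear f"
  obtains K where "0 \<le> K" "\<And>x. norm (f x) \<le> K * norm x"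
  using bounded_linear.nonneg_bounded[OF bounded_clinear_bounded_linear[OF assms]]
  by (metis mult.commute)

lemma bounded_clinear_compose:
  "bounded_clinear f \<Longrightarrow> bounded_clinear g \<Longrightarrow> bounded_clinear (\<lambda>x. f (g x))"
  by (simp add: bounded_clinear_def bounded_linear_compose)

lemma bounded_clinear_ident: "bounded_clinear (\<lambda>x. x)"
  by (simp add: bounded_clinear_def bounded_linear_ident)

lemma bounded_clinear_scaled:
  "bounded_clinear f \<Longrightarrow> bounded_clinear (\<lambda>x. c *\<^sub>C f x)"
  unfolding bounded_clinear_def
  by (auto simp: scaleC_scaleC mult.commute intro: bounded_linear_compose[OF bounded_linear_scaleC])

lemma bounded_clinear_sum:
  "bounded_clinear f \<Longrightarrow> bounded_clinear g \<Longrightarrow> bounded_clinear (\<lambda>x. f x + g x)"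
  by (auto simp: bounded_clinear_def scaleC_add_right intro: bounded_linear_add)

lemma bounded_clinear_difference:
  "bounded_clinear f \<Longrightarrow> bounded_clinear g \<Longrightarrow> bounded_clinear (\<lambda>x. f x - g x)"
  by (auto simp: bounded_clinear_def complex_vector.scale_right_diff_distrib intro: bounded_linear_sub)

lemma bounded_clinear_Jop: "bounded_clinear Jop"
  by (rule bounded_clinearI[where K = 1])
    (simp_all add: Jop_def scaleC_prod_def norm_prod_def add.commute)

section \<open>Orthogonal projection and Riesz representation\<close>

text \<open>Near-minimisers of the distance to \<open>M\<close> form a Cauchy sequence by the parallelogram law,
  and a nearest point has an orthogonal residual because moving it along \<open>z\<close> cannot decrease
  the distance.\<close>

lemma orthogonal_decomposition:
  fixes M :: "'a::complex_hilbert set"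
  assumes M: "complex_vector.subspace M" "closed M"
  obtains y where "y \<in> M" "\<And>z. z \<in> M \<Longrightarrow> cinner (x - y) z = 0"
proof -
  define d where "d = infdist x M"
  have ne: "M \<noteq> {}" using complex_vector.subspace_0[OF M(1)] by auto
  have d_le: "d \<le> norm (x - z)" if "z \<in> M" for z
    using infdist_le[OF that, of x] by (simp add: d_def dist_norm)
  have d0: "0 \<le> d" by (simp add: d_def infdist_nonneg)
  have "\<exists>y\<in>M. dist x y < d + inverse (real (Suc n))" for n
    using cInf_lessD[of "(\<lambda>a. dist x a) ` M" "d + inverse (real (Suc n))"] ne
    by (auto simp: d_def infdist_def)
  then obtain y where y: "\<And>n. y n \<in> M" "\<And>n. norm (x - y n) < d + inverse (real (Suc n))"
    by (metis dist_norm)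
  have half: "(1/2) *\<^sub>R (v + w) \<in> M" if "v \<in> M" "w \<in> M" for v w
    using that complex_vector.subspace_scale[OF M(1)] complex_vector.subspace_add[OF M(1)]
    by (simp add: scaleR_scaleC)
  have close: "(norm (y n - y k))\<^sup>2 \<le> 4 * e * (2 * d + e)"
    if "inverse (real (Suc n)) \<le> e" "inverse (real (Suc k)) \<le> e" for n k e
  proof -
    have e0: "0 < e" using that(1) by (smt (verit) inverse_positive_iff_positive of_nat_0_less_iff zero_less_Suc)
    have a: "(norm (x - y n))\<^sup>2 \<le> (d + e)\<^sup>2" "(norm (x - y k))\<^sup>2 \<le> (d + e)\<^sup>2"
      using y(2)[of n] y(2)[of k] that by (auto intro!: power_mono)
    have "d\<^sup>2 \<le> (norm (x - (1/2) *\<^sub>R (y n + y k)))\<^sup>2"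
      using d_le[OF half[OF y(1) y(1)]] d0 by (auto intro!: power_mono)
    moreover have "(norm ((x - y n) + (x - y k)))\<^sup>2 = 4 * (norm (x - (1/2) *\<^sub>R (y n + y k)))\<^sup>2"
    proof -
      have "(x - y n) + (x - y k) = 2 *\<^sub>R (x - (1/2) *\<^sub>R (y n + y k))"
        by (simp add: algebra_simps scaleR_2)
      then show ?thesis by (simp add: power_mult_distrib)
    qed
    moreover have "(norm ((x - y n) - (x - y k)))\<^sup>2 + (norm ((x - y n) + (x - y k)))\<^sup>2
        = 2 * (norm (x - y n))\<^sup>2 + 2 * (norm (x - y k))\<^sup>2"
      using norm_diff_square[of "x - y n" "x - y k"] norm_diff_square[of "x - y n" "- (x - y k)"]
      unfolding cinner_minus_right norm_minus_cancel diff_minus_eq_add by simp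
    moreover have "(norm ((x - y n) - (x - y k)))\<^sup>2 = (norm (y n - y k))\<^sup>2"
      by (simp add: norm_minus_commute)
    ultimately have "(norm (y n - y k))\<^sup>2 \<le> 4 * (d + e)\<^sup>2 - 4 * d\<^sup>2"
      using a by linarith
    then show ?thesis by (simp add: power2_eq_square algebra_simps)
  qed
  have "Cauchy y"
  proof (rule metric_CauchyI)
    fix \<epsilon> :: real assume \<epsilon>: "0 < \<epsilon>"
    define e where "e = min 1 (\<epsilon>\<^sup>2 / (8 * (2 * d + 1)))"
    have e: "0 < e" "e \<le> 1" using \<epsilon> d0 by (auto simp: e_def)
    have "4 * e * (2 * d + e) \<le> 4 * (\<epsilon>\<^sup>2 / (8 * (2 * d + 1))) * (2 * d + 1)"
      using e d0 by (intro mult_mono) (auto simp: e_def)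
    also have "\<dots> = \<epsilon>\<^sup>2 / 2" using d0 by (simp add: field_simps)
    also have "\<dots> < \<epsilon>\<^sup>2" using \<epsilon> by simp
    finally have lt: "4 * e * (2 * d + e) < \<epsilon>\<^sup>2" .
    obtain N where N: "inverse (real (Suc N)) < e" using reals_Archimedean[OF e(1)] by blast
    have "dist (y n) (y k) < \<epsilon>" if "n \<ge> N" "k \<ge> N" for n k
    proof -
      have "inverse (real (Suc n)) \<le> e" "inverse (real (Suc k)) \<le> e"
        using that N by (smt (verit, best) inverse_le_iff_le of_nat_0_less_iff of_nat_le_iff zero_less_Suc Suc_le_mono)+
      from close[OF this] lt have "(norm (y n - y k))\<^sup>2 < \<epsilon>\<^sup>2" by linarith
      then show ?thesis using \<epsilon> by (simp add: dist_norm power2_less_imp_less)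
    qed
    then show "\<exists>N. \<forall>n\<ge>N. \<forall>k\<ge>N. dist (y n) (y k) < \<epsilon>" by blast
  qed
  then obtain p where p: "y \<longlonglongrightarrow> p"
    using Cauchy_convergent convergent_def by blast
  have pM: "p \<in> M" using M(2) p y(1) closed_sequentially[of M y p] by simp
  have "(\<lambda>n. norm (x - y n)) \<longlonglongrightarrow> norm (x - p)"
    by (intro tendsto_intros p)
  moreover have "(\<lambda>n. d + inverse (real (Suc n))) \<longlonglongrightarrow> d + 0"
    by (intro tendsto_intros LIMSEQ_inverse_real_of_nat)
  ultimately have pd: "norm (x - p) \<le> d"
    using LIMSEQ_le[of "\<lambda>n. norm (x - y n)" "norm (x - p)"] y(2) by (simp add: less_imp_le)
  have "cinner (x - p) z = 0" if z: "z \<in> M" for z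
  proof (cases "z = 0")
    case False
    define c where "c = cinner (x - p) z / complex_of_real ((norm z)\<^sup>2)"
    have "p + c *\<^sub>C z \<in> M"
      by (intro complex_vector.subspace_add[OF M(1)] complex_vector.subspace_scale[OF M(1)] pM z)
    from d_le[OF this] pd have "norm (x - p) \<le> norm ((x - p) - c *\<^sub>C z)"
      by (simp add: diff_diff_eq)
    then have "(norm (x - p))\<^sup>2 \<le> (norm ((x - p) - c *\<^sub>C z))\<^sup>2"
      by (intro power_mono) auto
    also have "\<dots> = (norm (x - p))\<^sup>2 + (cmod c * norm z)\<^sup>2 - 2 * Re (cnj c * cinner (x - p) z)"
      by (simp add: norm_diff_square norm_scaleC cinner_scaleC_right)
    also have "cnj c * cinner (x - p) z = complex_of_real ((cmod c * norm z)\<^sup>2)"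
    proof -
      have "cinner (x - p) z = c * complex_of_real ((norm z)\<^sup>2)"
        using False by (simp add: c_def)
      then show ?thesis
        using complex_norm_square[of c] by (simp add: power_mult_distrib mult.commute mult.left_commute)
    qed
    finally have "cmod c * norm z = 0" by simp
    then show ?thesis using False by (simp add: c_def)
  qed simp
  with pM show thesis by (rule that)
qed

lemma proj_onto:
  fixes M :: "'a::complex_hilbert set"
  assumes M: "complex_vector.subspace M" "closed M"
  shows "proj_onto M x \<in> M" "\<And>z. z \<in> M \<Longrightarrow> cinner (x - proj_onto M x) z = 0"
proof -
  obtain y where y: "y \<in> M \<and> (\<forall>z\<in>M. cinner (x - y) z = 0)"
    using orthogonal_decomposition[OF M] by metis
  have "y' = y" if "y' \<in> M \<and> (\<forall>z\<in>M. cinner (x - y') z = 0)" for y'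
  proof -
    have "y' - y \<in> M" using that y M(1) complex_vector.subspace_diff by blast
    then have "cinner (x - y) (y' - y) - cinner (x - y') (y' - y) = 0" using that y by simp
    then have "cinner (y' - y) (y' - y) = 0" by (simp add: cinner_diff_left)
    then show ?thesis by (simp add: cinner_self_eq_0)
  qed
  with y have "proj_onto M x \<in> M \<and> (\<forall>z\<in>M. cinner (x - proj_onto M x) z = 0)"
    unfolding proj_onto_def by (rule theI)
  then show "proj_onto M x \<in> M" "\<And>z. z \<in> M \<Longrightarrow> cinner (x - proj_onto M x) z = 0" by auto
qed

text \<open>The representing vector is a multiple of the component of any \<open>x0\<close> with \<open>\<phi> x0 \<noteq> 0\<close> that is
  orthogonal to the kernel of \<open>\<phi>\<close>.\<close>

lemma riesz_representation:
  fixes \<phi> :: "'a::complex_hilbert \<Rightarrow> complex"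
  assumes "bounded_linear \<phi>" and hom: "\<And>c x. \<phi> (c *\<^sub>C x) = c * \<phi> x"
  obtains y where "\<And>x. \<phi> x = cinner x y"
proof (cases "\<forall>x. \<phi> x = 0")
  case True
  then show thesis using that[of 0] by simp
next
  case False
  then obtain x0 where x0: "\<phi> x0 \<noteq> 0" by blast
  interpret bounded_linear \<phi> by fact
  let ?M = "{x. \<phi> x = 0}"
  have "complex_vector.subspace ?M"
    using hom zero add by (auto simp: complex_vector.subspace_def)
  moreover have "closed ?M"
    by (intro closed_Collect_eq continuous_intros linear_continuous_on assms)
  ultimately obtain p where p: "p \<in> ?M" "\<And>z. z \<in> ?M \<Longrightarrow> cinner (x0 - p) z = 0"
    by (rule orthogonal_decomposition[where x = x0]) blast
  define n where "n = x0 - p"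
  have n: "\<phi> n \<noteq> 0" "cinner z n = 0" if "\<phi> z = 0" for z
    using p x0 that cinner_commute[of z n] by (simp_all add: n_def diff)
  then have nn: "cinner n n \<noteq> 0"
    using cinner_self_eq_0 zero n(1)[OF zero] by metis
  have "\<phi> x = cinner x (cnj (\<phi> n / cinner n n) *\<^sub>C n)" for x
  proof -
    have "\<phi> (x - (\<phi> x / \<phi> n) *\<^sub>C n) = 0" using n(1)[OF zero] by (simp add: diff hom)
    from n(2)[OF this] n(1)[OF zero] have "cinner x n = \<phi> x / \<phi> n * cinner n n" by (simp add: cinner_simps)
    then show ?thesis using n(1)[OF zero] nn by (simp add: cinner_scaleC_right)
  qed
  then show thesis by (rule that)
qed

text \<open>Riesz representation provides the operator that the definite description in \<open>cadjoint\<close>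
  selects.\<close>

lemma cinner_cadjoint:
  fixes f :: "'a::complex_hilbert \<Rightarrow> 'b::complex_hilbert"
  assumes f: "bounded_clinear f"
  shows "cinner (f x) y = cinner x (cadjoint f y)"
proof -
  have "\<exists>w. \<forall>x. cinner (f x) y = cinner x w" for y
  proof -
    have "bounded_linear (\<lambda>x. cinner (f x) y)"
      by (rule bounded_linear_compose[OF bounded_linear_cinner_left bounded_clinear_bounded_linear[OF f]])
    moreover have "cinner (f (c *\<^sub>C x)) y = c * cinner (f x) y" for c x
      by (simp add: bounded_clinear_scaleC[OF f] cinner_simps)
    ultimately show ?thesis using riesz_representation[of "\<lambda>x. cinner (f x) y"] by metis
  qed
  then obtain g where g: "\<And>x y. cinner (f x) y = cinner x (g y)" by metis
  have "\<forall>x y. cinner (f x) y = cinner x (cadjoint f y)"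
    unfolding cadjoint_def
  proof (rule theI[where P = "\<lambda>g. \<forall>x y. cinner (f x) y = cinner x (g y)"])
    show "\<forall>x y. cinner (f x) y = cinner x (g y)" using g by blast
    fix g' assume "\<forall>x y. cinner (f x) y = cinner x (g' y)"
    then have "g' y = g y" for y
      using g by (intro cinner_ext_right) metis
    then show "g' = g" by blast
  qed
  then show ?thesis by blast
qed

lemma cinner_cadjoint_left:
  "bounded_clinear f \<Longrightarrow> cinner (cadjoint f y) x = cinner y (f x)"
  by (metis cinner_cadjoint cinner_commute)

lemma cadjoint_eqI:
  assumes "bounded_clinear f" "\<And>x. cinner (f x) y = cinner x w"
  shows "cadjoint f y = w"
  using assms by (intro cinner_ext_right) (simp add: cinner_cadjoint[symmetric])

lemma bounded_clinear_cadjoint: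
  assumes f: "bounded_clinear f"
  shows "bounded_clinear (cadjoint f)"
proof -
  obtain K where K: "0 \<le> K" "\<And>x. norm (f x) \<le> K * norm x" using f bounded_clinear_bound by blast
  have "norm (cadjoint f y) \<le> norm y * K" for y
  proof (cases "norm (cadjoint f y) = 0")
    case False
    let ?w = "cadjoint f y"
    have "(norm ?w)\<^sup>2 = cmod (cinner ?w ?w)" by (simp add: cinner_self norm_power)
    also have "\<dots> = cmod (cinner y (f ?w))" by (simp add: cinner_cadjoint_left[OF f])
    also have "\<dots> \<le> norm y * (K * norm ?w)"
      by (rule order_trans[OF norm_cinner_le mult_left_mono[OF K(2)]]) simp
    finally have "norm ?w * norm ?w \<le> (norm y * K) * norm ?w" by (simp add: power2_eq_square)
    then show ?thesis using False by (simp add: mult_le_cancel_right)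
  qed (use K in simp)
  then show ?thesis
    by (intro bounded_clinearI[where K = K] cadjoint_eqI[OF f])
      (simp_all add: cinner_simps cinner_cadjoint[OF f])
qed

section \<open>The reduced resolvent of a self-adjoint operator\<close>

text \<open>If a function is holomorphic near \<open>a\<close> except at \<open>a\<close> itself and grows at most like
  \<open>1 / \<bar>Im (z - a)\<bar>\<close>, then the coefficient at \<open>(z - a)\<^sup>-\<^sup>2\<close> of its Laurent series vanishes. On the circle
  of radius \<open>\<epsilon>\<close> about \<open>a\<close> the weight \<open>(z - a) - \<epsilon>\<^sup>2 / (z - a)\<close> equals \<open>2 \<i> Im (z - a)\<close>, so it compensates
  the growth. Hence the integral of the weighted function is \<open>O(\<epsilon>)\<close>, whereas the integrals belonging to
  the two parts of the weight can be computed on a fixed circle.\<close>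

lemma contour_integral_circlepath_simple_pole:
  fixes h :: "complex \<Rightarrow> complex"
  assumes hol: "h holomorphic_on (ball a \<rho> - {a})" and r: "0 < r" "r < \<rho>" and C: "0 \<le> C"
    and bound: "\<And>z. z \<in> ball a \<rho> - {a} \<Longrightarrow> \<bar>Im (z - a)\<bar> * cmod (h z) \<le> C"
  shows "contour_integral (circlepath a r) (\<lambda>z. (z - a) * h z) = 0"
proof -
  let ?g = "\<lambda>z. (z - a) * h z" and ?k = "\<lambda>z. h z / (z - a)"
  define I J where "I = contour_integral (circlepath a r) ?g"
    and "J = contour_integral (circlepath a r) ?k"
  have hols: "?g holomorphic_on (ball a \<rho> - {a})" "?k holomorphic_on (ball a \<rho> - {a})"
    by (intro holomorphic_intros hol; simp)+
  have sub: "cball a r \<subseteq> ball a \<rho>" using r by auto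
  have est: "cmod I \<le> \<epsilon>\<^sup>2 * cmod J + 4 * pi * C * \<epsilon>" if \<epsilon>: "0 < \<epsilon>" "\<epsilon> \<le> r" for \<epsilon>
  proof -
    note eqs = contour_integral_circlepath_eq[OF open_ball hols(1) \<epsilon> sub]
      contour_integral_circlepath_eq[OF open_ball hols(2) \<epsilon> sub]
    have "((\<lambda>z. ?g z - \<epsilon>\<^sup>2 * ?k z) has_contour_integral
        (contour_integral (circlepath a \<epsilon>) ?g - \<epsilon>\<^sup>2 * contour_integral (circlepath a \<epsilon>) ?k)) (circlepath a \<epsilon>)"
      using eqs by (intro has_contour_integral_diff has_contour_integral_lmul has_contour_integral_integral)
    then have hci: "((\<lambda>z. ?g z - \<epsilon>\<^sup>2 * ?k z) has_contour_integral (I - \<epsilon>\<^sup>2 * J)) (circlepath a \<epsilon>)"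
      using eqs(3,6) by (simp add: I_def J_def)
    \<comment> \<open>On the circle \<open>\<epsilon>\<^sup>2 / (z - a)\<close> is the conjugate of \<open>z - a\<close>.\<close>
    have "cmod (I - \<epsilon>\<^sup>2 * J) \<le> (2 * C) * (2 * pi * \<epsilon>)"
    proof (rule has_contour_integral_bound_circlepath[OF hci])
      fix z assume z: "cmod (z - a) = \<epsilon>"
      then have za: "z \<noteq> a" and zin: "z \<in> ball a \<rho> - {a}"
        using \<epsilon> r by (auto simp: dist_norm norm_minus_commute)
      have e: "(complex_of_real \<epsilon>)\<^sup>2 = (z - a) * cnj (z - a)"
        using complex_norm_square[of "z - a"] z by simp
      have "?g z - \<epsilon>\<^sup>2 * ?k z = ((z - a) - cnj (z - a)) * h z"
        using za by (simp add: e field_simps)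
      also have "\<dots> = (2 * \<i> * Im (z - a)) * h z"
        by (simp only: complex_diff_cnj) (simp add: mult.commute)
      finally have "cmod (?g z - \<epsilon>\<^sup>2 * ?k z) = 2 * (\<bar>Im (z - a)\<bar> * cmod (h z))"
        by (simp add: norm_mult del: minus_complex.simps)
      then show "cmod (?g z - \<epsilon>\<^sup>2 * ?k z) \<le> 2 * C" using bound[OF zin] by simp
    qed (use C \<epsilon> in auto)
    moreover have "cmod I \<le> cmod (I - \<epsilon>\<^sup>2 * J) + cmod (\<epsilon>\<^sup>2 * J)"
      by (metis add.commute diff_add_cancel norm_triangle_ineq)
    ultimately show ?thesis by (simp add: norm_mult norm_power algebra_simps)
  qed
  have "((\<lambda>\<epsilon>. \<epsilon>\<^sup>2 * cmod J + 4 * pi * C * \<epsilon>) \<longlongrightarrow> 0\<^sup>2 * cmod J + 4 * pi * C * 0) (at_right 0)"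
    by (intro tendsto_intros)
  moreover have "\<forall>\<^sub>F \<epsilon> in at_right 0. cmod I \<le> \<epsilon>\<^sup>2 * cmod J + 4 * pi * C * \<epsilon>"
    using eventually_at_right[of 0 r] r(1) est by (auto intro!: exI[of _ r] simp: eventually_at_right[of 0 r])
  ultimately have "cmod I \<le> 0\<^sup>2 * cmod J + 4 * pi * C * 0"
    by (intro tendsto_lowerbound) auto
  then show ?thesis by (simp add: I_def)
qed

text \<open>Self-adjointness is used below in two forms: as symmetry, and as the rule that a vector
  belongs to the domain as soon as it behaves weakly as if it did.\<close>

locale selfadjoint_op =
  fixes G :: "('h::complex_hilbert \<times> 'h) set"
  assumes linear: "linear_op G" and selfadjoint: "adjoint_op G = G"
begin

lemma symmetric: "(x, y) \<in> G \<Longrightarrow> (v, w) \<in> G \<Longrightarrow> cinner y v = cinner x w"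
  using selfadjoint by (fastforce simp: adjoint_op_def)

lemma weak_membership: "(\<And>x y. (x, y) \<in> G \<Longrightarrow> cinner v y = cinner w x) \<Longrightarrow> (v, w) \<in> G"
  by (subst selfadjoint[symmetric]) (auto simp: adjoint_op_def, metis cinner_commute)

lemma scale_mem: "(x, y) \<in> G \<Longrightarrow> (c *\<^sub>C x, c *\<^sub>C y) \<in> G"
  using linear complex_vector.subspace_scale[of G "(x, y)" c]
  by (simp add: linear_op_def scaleC_prod_def)

lemma eigenvalue_real:
  assumes "(u, l *\<^sub>C u) \<in> G" "u \<noteq> 0"
  shows "cnj l = l"
  using symmetric[OF assms(1) assms(1)] assms(2) by (simp add: cinner_simps cinner_self_eq_0)

lemma resolvent_mem:
  assumes "z \<notin> spectrum G"
  shows "(resolvent G z f, f + z *\<^sub>C resolvent G z f) \<in> G"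
  using assms theI'[of "\<lambda>u. (u, f + z *\<^sub>C u) \<in> G"] by (auto simp: spectrum_def resolvent_def)

lemma resolvent_eqI:
  assumes "z \<notin> spectrum G" "(u, f + z *\<^sub>C u) \<in> G"
  shows "resolvent G z f = u"
  using assms by (auto simp: spectrum_def resolvent_def intro: the1_equality)

lemma bounded_clinear_resolvent: "z \<notin> spectrum G \<Longrightarrow> bounded_clinear (resolvent G z)"
  by (simp add: spectrum_def)

lemma resolvent_apply:
  assumes "z \<notin> spectrum G" "(u, w) \<in> G"
  shows "resolvent G z w = u + z *\<^sub>C resolvent G z u"
proof -
  have "resolvent G z (w - z *\<^sub>C u) = u" using assms by (intro resolvent_eqI) auto
  then show ?thesis
    using bounded_clinear_resolvent[OF assms(1)]
    by (simp add: bounded_clinear_diff bounded_clinear_scaleC algebra_simps)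
qed

lemma resolvent_identity:
  assumes "z \<notin> spectrum G" "w \<notin> spectrum G"
  shows "resolvent G z x - resolvent G w x = (z - w) *\<^sub>C resolvent G z (resolvent G w x)"
  using resolvent_apply[OF assms(1) resolvent_mem[OF assms(2)], of x]
    bounded_clinear_resolvent[OF assms(1)]
  by (simp add: bounded_clinear_add bounded_clinear_scaleC complex_vector.scale_left_diff_distrib
      algebra_simps)

text \<open>The quadratic form of \<open>A\<close> is real, so the imaginary part of \<open>\<langle>(A - z) u, u\<rangle>\<close> is
  \<open>- Im z \<parallel>u\<parallel>\<^sup>2\<close>.\<close>

lemma resolvent_growth:
  assumes z: "z \<notin> spectrum G"
  shows "\<bar>Im z\<bar> * norm (resolvent G z x) \<le> norm x"
proof (cases "resolvent G z x = 0")
  case False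
  define u where "u = resolvent G z x"
  have "cinner (x + z *\<^sub>C u) u = cinner u (x + z *\<^sub>C u)"
    using symmetric[OF resolvent_mem[OF z] resolvent_mem[OF z]] by (simp add: u_def)
  then have "(z - cnj z) * cinner u u = cinner u x - cinner x u"
    by (simp add: cinner_simps algebra_simps)
  then have "cmod (z - cnj z) * (norm u)\<^sup>2 = cmod (cinner u x - cinner x u)"
    by (metis abs_of_nonneg cinner_self norm_mult norm_of_real zero_le_power2)
  also have "\<dots> \<le> 2 * (norm u * norm x)"
    using norm_triangle_ineq4[of "cinner u x" "cinner x u"] norm_cinner_le[of u x] norm_cinner_le[of x u]
    by (simp add: mult.commute)
  also have "cmod (z - cnj z) = 2 * \<bar>Im z\<bar>"
    by (simp add: complex_diff_cnj norm_mult)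
  finally show ?thesis
    using False by (simp add: u_def power2_eq_square)
qed simp

text \<open>For \<open>z\<close> near \<open>w\<close> the resolvent identity bounds \<open>R(z)\<close> by twice any bound of \<open>R(w)\<close>, because the term containing
  \<open>R(z)\<close> on its right-hand side is absorbed on the left; a second use of the identity gives the Lipschitz
  estimate. This works at real \<open>w\<close> too, where the growth bound is void.\<close>

lemma resolvent_locally_Lipschitz:
  assumes w: "w \<notin> spectrum G"
  obtains N where "0 < N"
    "\<And>z x. z \<notin> spectrum G \<Longrightarrow> cmod (z - w) * N \<le> 1/2 \<Longrightarrow>
      norm (resolvent G z x - resolvent G w x) \<le> 2 * N\<^sup>2 * cmod (z - w) * norm x"
proof -
  obtain K where K: "0 \<le> K" "\<And>x. norm (resolvent G w x) \<le> K * norm x"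
    using bounded_clinear_bound[OF bounded_clinear_resolvent[OF w]] by blast
  \<comment> \<open>Adding 1 keeps \<open>N\<close> positive when the resolvent vanishes.\<close>
  define N where "N = K + 1"
  have N: "0 < N" "\<And>x. norm (resolvent G w x) \<le> N * norm x"
  proof -
    show "0 < N" using K(1) by (simp add: N_def)
    show "norm (resolvent G w x) \<le> N * norm x" for x
      unfolding N_def distrib_right using K(2)[of x] norm_ge_zero[of x] by linarith
  qed
  have "norm (resolvent G z x - resolvent G w x) \<le> 2 * N\<^sup>2 * cmod (z - w) * norm x"
    if z: "z \<notin> spectrum G" "cmod (z - w) * N \<le> 1/2" for z x
  proof -
    let ?v = "resolvent G z x"
    have eq: "norm (?v - resolvent G w x) = cmod (z - w) * norm (resolvent G w ?v)"
      unfolding norm_minus_commute[of ?v] resolvent_identity[OF w z(1)] norm_scaleC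
      by (simp add: norm_minus_commute)
    have "norm ?v \<le> norm (resolvent G w x) + norm (?v - resolvent G w x)"
      using norm_triangle_sub[of ?v "resolvent G w x"] by simp
    also have "norm (?v - resolvent G w x) \<le> cmod (z - w) * (N * norm ?v)"
      unfolding eq by (intro mult_left_mono N) simp
    also have "\<dots> \<le> norm ?v / 2"
      using mult_right_mono[OF z(2), of "norm ?v"] by (simp add: mult.assoc)
    finally have "norm ?v \<le> 2 * (N * norm x)" using N(2)[of x] by simp
    then have "norm (resolvent G w ?v) \<le> N * (2 * (N * norm x))"
      using order_trans[OF N(2) mult_left_mono[of "norm ?v" _ N]] N(1) by simp
    from mult_left_mono[OF this norm_ge_zero[of "z - w"]] show ?thesis
      unfolding eq by (simp add: power2_eq_square mult.assoc mult.left_commute)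
  qed
  with N(1) show thesis by (rule that)
qed

lemma continuous_on_resolvent:
  "continuous_on (- spectrum G) (\<lambda>z. Blinfun (resolvent G z))"
proof -
  have "((\<lambda>z. Blinfun (resolvent G z)) \<longlongrightarrow> Blinfun (resolvent G w)) (at w within - spectrum G)"
    if w: "w \<notin> spectrum G" for w
  proof -
    obtain N where N: "0 < N" "\<And>z x. z \<notin> spectrum G \<Longrightarrow> cmod (z - w) * N \<le> 1/2 \<Longrightarrow>
      norm (resolvent G z x - resolvent G w x) \<le> 2 * N\<^sup>2 * cmod (z - w) * norm x"
      using resolvent_locally_Lipschitz[OF w] by blast
    have "norm (Blinfun (resolvent G z) - Blinfun (resolvent G w)) \<le> 2 * N\<^sup>2 * cmod (z - w)"
      if "z \<notin> spectrum G" "cmod (z - w) * N \<le> 1/2" for z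
      using N that w
      by (intro norm_blinfun_bound)
        (auto simp: blinfun.bilinear_simps bounded_linear_Blinfun_apply
          bounded_clinear_bounded_linear bounded_clinear_resolvent)
    moreover have "\<forall>\<^sub>F z in at w within - spectrum G. z \<notin> spectrum G \<and> cmod (z - w) * N \<le> 1/2"
      unfolding eventually_at using N(1)
      by (intro exI[of _ "1 / (2 * N)"]) (auto simp: dist_norm field_simps)
    ultimately have "\<forall>\<^sub>F z in at w within - spectrum G.
        norm (Blinfun (resolvent G z) - Blinfun (resolvent G w)) \<le> 2 * N\<^sup>2 * cmod (z - w)"
      by (auto elim: eventually_mono)
    moreover have "((\<lambda>z. 2 * N\<^sup>2 * cmod (z - w)) \<longlongrightarrow> 0) (at w within - spectrum G)"
      by (rule tendsto_eq_intros refl | simp)+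
    ultimately have "((\<lambda>z. Blinfun (resolvent G z) - Blinfun (resolvent G w)) \<longlongrightarrow> 0)
        (at w within - spectrum G)"
      by (rule Lim_null_comparison)
    then show ?thesis by (rule LIM_zero_cancel)
  qed
  then show ?thesis by (simp add: continuous_on_def)
qed

lemma tendsto_resolvent:
  assumes "w \<notin> spectrum G"
  shows "((\<lambda>z. resolvent G z x) \<longlongrightarrow> resolvent G w x) (at w within - spectrum G)"
proof -
  have "((\<lambda>z. blinfun_apply (Blinfun (resolvent G z)) x) \<longlongrightarrow> blinfun_apply (Blinfun (resolvent G w)) x)
      (at w within - spectrum G)"
    using continuous_on_resolvent assms
    by (intro blinfun.tendsto tendsto_const) (simp add: continuous_on_def)
  moreover have "\<forall>\<^sub>F z in at w within - spectrum G.
      blinfun_apply (Blinfun (resolvent G z)) x = resolvent G z x"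
    unfolding eventually_at
    by (auto simp: bounded_linear_Blinfun_apply bounded_clinear_bounded_linear
        bounded_clinear_resolvent intro!: exI[of _ 1])
  ultimately show ?thesis
    using assms
    by (simp add: bounded_linear_Blinfun_apply bounded_clinear_bounded_linear
        bounded_clinear_resolvent tendsto_cong)
qed

lemma holomorphic_resolvent:
  assumes "open X" "X \<inter> spectrum G = {}"
  shows "(\<lambda>z. cinner (resolvent G z x) y) holomorphic_on X"
proof -
  have "((\<lambda>z. cinner (resolvent G z x) y) has_field_derivative
      cinner (resolvent G w (resolvent G w x)) y) (at w within X)" if w: "w \<in> X" for w
  proof -
    have ws: "w \<notin> spectrum G" using w assms by auto
    have "((\<lambda>z. cinner (resolvent G z (resolvent G w x)) y) \<longlongrightarrow>
        cinner (resolvent G w (resolvent G w x)) y) (at w within X)"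
      using assms
      by (intro bounded_linear.tendsto[OF bounded_linear_cinner_left]
          tendsto_within_subset[OF tendsto_resolvent[OF ws]]) auto
    moreover have "\<forall>\<^sub>F z in at w within X.
        (cinner (resolvent G z x) y - cinner (resolvent G w x) y) / (z - w)
          = cinner (resolvent G z (resolvent G w x)) y"
    proof -
      have "(cinner (resolvent G z x) y - cinner (resolvent G w x) y) / (z - w)
          = cinner (resolvent G z (resolvent G w x)) y" if "z \<in> X" "z \<noteq> w" for z
      proof -
        have "z \<notin> spectrum G" using that assms by auto
        from resolvent_identity[OF this ws, of x] that show ?thesis
          by (simp add: cinner_diff_left[symmetric] cinner_scaleC_left)
      qed
      then show ?thesis unfolding eventually_at by (intro exI[of _ 1]) auto
    qed
    ultimately show ?thesis unfolding has_field_derivative_iff by (subst tendsto_cong)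
  qed
  then show ?thesis unfolding holomorphic_on_def field_differentiable_def by blast
qed

end

text \<open>Scalar contour integrals determine the operator-valued one: the integrand is continuous
  in the operator norm, so evaluating and pairing commute with integration.\<close>

lemma (in selfadjoint_op) cinner_op_contour_integral:
  assumes off: "path_image (circlepath a r) \<inter> spectrum G = {}"
    and k: "continuous_on (path_image (circlepath a r)) k"
  shows "cinner (op_contour_integral (circlepath a r) (\<lambda>z y. k z *\<^sub>C resolvent G z y) x) y
    = contour_integral (circlepath a r) (\<lambda>z. k z * cinner (resolvent G z x) y)"
    (is "cinner (op_contour_integral ?g _ _) _ = _")
proof -
  have img: "?g s \<in> path_image ?g" if "s \<in> {0..1}" for s
    using that by (auto simp: path_image_def)
  have g: "?g s \<notin> spectrum G" if "s \<in> {0..1}" for s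
    using off img[OF that] by blast
  define c where "c s = vector_derivative ?g (at s within {0..1}) * k (?g s)" for s
  define B where "B s = Blinfun (\<lambda>x. vector_derivative ?g (at s within {0..1}) *\<^sub>C
      (k (?g s) *\<^sub>C resolvent G (?g s) x))" for s
  define M :: "complex \<Rightarrow> 'h \<Rightarrow>\<^sub>L 'h" where "M c = Blinfun (\<lambda>x. c *\<^sub>C x)" for c
  have M: "blinfun_apply (M c) x = c *\<^sub>C x" for c x
    by (simp add: M_def bounded_linear_Blinfun_apply bounded_linear_scaleC)
  have "bounded_linear M"
    by (rule bounded_linear_intro[where K = 1])
      (auto intro!: blinfun_eqI norm_blinfun_bound
        simp: M blinfun.bilinear_simps scaleC_add_left scaleR_scaleC scaleC_scaleC norm_scaleC
          scaleR_conv_of_real)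
  have cont_g: "continuous_on {0..1} ?g"
    using path_circlepath[of a r] by (simp add: path_def)
  have cont_k: "continuous_on {0..1} (\<lambda>s. k (?g s))"
    using continuous_on_compose2[OF k cont_g] img by blast
  have "continuous_on {0..1} (\<lambda>s. (2 * pi * \<i> * r * exp (2 * of_real pi * \<i> * complex_of_real s)) * k (?g s))"
    by (intro continuous_intros cont_k)
  then have cont_c: "continuous_on {0..1} c"
    by (rule continuous_on_eq) (simp add: c_def vector_derivative_circlepath01)
  have cont_R: "continuous_on {0..1} (\<lambda>s. Blinfun (resolvent G (?g s)))"
    using continuous_on_compose2[OF continuous_on_resolvent cont_g] g by blast
  have cont: "continuous_on {0..1} (\<lambda>s. M (c s) o\<^sub>L Blinfun (resolvent G (?g s)))"
    by (intro bounded_bilinear.continuous_on[OF bounded_bilinear_blinfun_compose]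
        bounded_linear.continuous_on[OF \<open>bounded_linear M\<close>] cont_c cont_R)
  have app: "blinfun_apply (B s) x = c s *\<^sub>C resolvent G (?g s) x" if "s \<in> {0..1}" for s x
  proof -
    have "bounded_linear (\<lambda>x. c s *\<^sub>C resolvent G (?g s) x)"
      using bounded_linear_compose[OF bounded_linear_scaleC
        bounded_clinear_bounded_linear[OF bounded_clinear_resolvent[OF g[OF that]]]] .
    then show ?thesis
      by (simp add: B_def c_def scaleC_scaleC bounded_linear_Blinfun_apply)
  qed
  have "continuous_on {0..1} B"
    by (rule continuous_on_eq[OF cont])
      (auto intro!: blinfun_eqI
        simp: app M g bounded_linear_Blinfun_apply bounded_clinear_bounded_linear bounded_clinear_resolvent)
  then have "(B has_integral integral {0..1} B) {0..1}"
    by (intro integrable_integral integrable_continuous_real)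
  then have "((\<lambda>s. cinner (blinfun_apply (B s) x) y) has_integral
      cinner (blinfun_apply (integral {0..1} B) x) y) {0..1}"
    using has_integral_linear[OF _ bounded_linear_compose[OF bounded_linear_cinner_left
        blinfun.bounded_linear_left]] by (simp add: o_def)
  then have "((\<lambda>s. k (?g s) * cinner (resolvent G (?g s) x) y
      * vector_derivative ?g (at s within {0..1})) has_integral
      cinner (blinfun_apply (integral {0..1} B) x) y) {0..1}"
    by (rule has_integral_eq[rotated]) (simp add: app cinner_simps c_def)
  then have "((\<lambda>z. k z * cinner (resolvent G z x) y) has_contour_integral
      cinner (blinfun_apply (integral {0..1} B) x) y) ?g"
    by (simp add: has_contour_integral_def)
  from contour_integral_unique[OF this] show ?thesis
    by (simp add: op_contour_integral_def B_def[abs_def])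
qed

lemma bounded_linear_op_contour_integral: "bounded_linear (op_contour_integral g F)"
  unfolding op_contour_integral_def by (rule blinfun.bounded_linear_right)

locale isolated_eigenvalue = selfadjoint_op G for G :: "('h::complex_hilbert \<times> 'h) set" +
  fixes lam :: complex
  assumes isolated: "\<exists>\<epsilon>>0. ball lam \<epsilon> \<inter> spectrum G = {lam}"
    and eigenvector: "\<exists>u. u \<noteq> 0 \<and> (u, lam *\<^sub>C u) \<in> G"
begin

abbreviation "\<gamma> \<equiv> circlepath lam (half_gap G lam)"

definition riesz_projection :: "'h \<Rightarrow> 'h" where
  "riesz_projection x = (- 1 / (2 * pi * \<i>)) *\<^sub>C op_contour_integral \<gamma> (resolvent G) x"

definition reduced_resolvent :: "'h \<Rightarrow> 'h" where
  "reduced_resolvent x = (- 1 / (2 * pi * \<i>)) *\<^sub>C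
     op_contour_integral \<gamma> (\<lambda>z y. inverse (lam - z) *\<^sub>C resolvent G z y) x"

lemma lam_real: "cnj lam = lam"
  using eigenvector eigenvalue_real by blast

lemma half_gap_pos: "0 < half_gap G lam"
proof (cases "spectrum G - {lam} = {}")
  case False
  obtain \<epsilon> where \<epsilon>: "0 < \<epsilon>" "ball lam \<epsilon> \<inter> spectrum G = {lam}" using isolated by blast
  have "\<epsilon> \<le> infdist lam (spectrum G - {lam})"
    unfolding infdist_notempty[OF False]
    using False \<epsilon>(2) by (intro cINF_greatest) (auto simp: not_less[symmetric] simp flip: mem_ball)
  then show ?thesis using False \<epsilon>(1) by (simp add: half_gap_def)
qed (simp add: half_gap_def)

lemma punctured_ball_resolvent_set:
  "(ball lam (2 * half_gap G lam) - {lam}) \<inter> spectrum G = {}"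
proof -
  have "z \<notin> ball lam (2 * half_gap G lam)" if z: "z \<in> spectrum G" "z \<noteq> lam" for z
  proof -
    have "half_gap G lam = infdist lam (spectrum G - {lam}) / 2"
      using z by (auto simp: half_gap_def)
    moreover have "infdist lam (spectrum G - {lam}) \<le> dist lam z"
      using z by (intro infdist_le) auto
    ultimately show ?thesis by simp
  qed
  then show ?thesis by blast
qed

lemma contour_in_punctured_ball: "path_image \<gamma> \<subseteq> ball lam (2 * half_gap G lam) - {lam}"
  using half_gap_pos by (auto simp: path_image_circlepath_nonneg sphere_def)

lemma contour_resolvent_set: "path_image \<gamma> \<inter> spectrum G = {}"
  using contour_in_punctured_ball punctured_ball_resolvent_set by blast

lemma contour_nonzero: "z \<in> path_image \<gamma> \<Longrightarrow> lam - z \<noteq> 0"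
  using contour_in_punctured_ball by auto

lemma holomorphic_matrix_element:
  "(\<lambda>z. cinner (resolvent G z x) y) holomorphic_on (ball lam (2 * half_gap G lam) - {lam})"
  using punctured_ball_resolvent_set by (intro holomorphic_resolvent) auto

lemma matrix_element_integrable:
  assumes "continuous_on (path_image \<gamma>) k"
  shows "(\<lambda>z. k z * cinner (resolvent G z x) y) contour_integrable_on \<gamma>"
  by (intro contour_integrable_continuous_circlepath continuous_on_mult assms
      holomorphic_on_imp_continuous_on holomorphic_on_subset[OF holomorphic_matrix_element]
      contour_in_punctured_ball)

lemma continuous_on_contour_inverse: "continuous_on (path_image \<gamma>) (\<lambda>z. inverse (lam - z))"
  using contour_nonzero by (intro continuous_intros) auto

lemma cinner_riesz_projection:
  "((\<lambda>z. cinner (resolvent G z x) y) has_contour_integral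
      - (2 * pi * \<i>) * cinner (riesz_projection x) y) \<gamma>"
proof -
  have "cinner (op_contour_integral \<gamma> (\<lambda>z y. 1 *\<^sub>C resolvent G z y) x) y
      = contour_integral \<gamma> (\<lambda>z. 1 * cinner (resolvent G z x) y)"
    by (rule cinner_op_contour_integral[OF contour_resolvent_set continuous_on_const])
  then have "cinner (op_contour_integral \<gamma> (resolvent G) x) y
      = contour_integral \<gamma> (\<lambda>z. cinner (resolvent G z x) y)"
    by (simp add: scaleC_one)
  then have "contour_integral \<gamma> (\<lambda>z. cinner (resolvent G z x) y)
      = - (2 * pi * \<i>) * cinner (riesz_projection x) y"
    by (simp add: riesz_projection_def cinner_simps)
  with has_contour_integral_integral[OF matrix_element_integrable[OF continuous_on_const[of _ 1]], of x y]
  show ?thesis by simp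
qed

lemma cinner_reduced_resolvent:
  "((\<lambda>z. inverse (lam - z) * cinner (resolvent G z x) y) has_contour_integral
      - (2 * pi * \<i>) * cinner (reduced_resolvent x) y) \<gamma>"
proof -
  have "contour_integral \<gamma> (\<lambda>z. inverse (lam - z) * cinner (resolvent G z x) y)
      = - (2 * pi * \<i>) * cinner (reduced_resolvent x) y"
    using cinner_op_contour_integral[OF contour_resolvent_set continuous_on_contour_inverse, of x y]
    by (simp add: reduced_resolvent_def cinner_simps)
  with has_contour_integral_integral[OF matrix_element_integrable[OF continuous_on_contour_inverse], of x y]
  show ?thesis by simp
qed

lemma contour_integral_inverse_square:
  "((\<lambda>z. inverse (lam - z) * inverse (lam - z)) has_contour_integral 0) \<gamma>"
proof -
  have "((\<lambda>z. inverse (lam - z) * inverse (lam - z)) has_contour_integral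
      inverse (lam - pathfinish \<gamma>) - inverse (lam - pathstart \<gamma>)) \<gamma>"
  proof (rule contour_integral_primitive[where S = "- {lam}"])
    show "((\<lambda>z. inverse (lam - z)) has_field_derivative inverse (lam - z) * inverse (lam - z))
        (at z within - {lam})" if "z \<in> - {lam}" for z
      using that by (auto intro!: derivative_eq_intros simp: power2_eq_square)
  qed (use contour_nonzero in auto)
  then show ?thesis by simp
qed

lemma contour_integral_inverse:
  "((\<lambda>z. inverse (lam - z)) has_contour_integral - (2 * pi * \<i>)) \<gamma>"
proof -
  have "(\<lambda>z. inverse (lam - z)) contour_integrable_on \<gamma>"
    by (intro contour_integrable_continuous_circlepath continuous_on_contour_inverse)
  moreover have "contour_integral \<gamma> (\<lambda>z. inverse (lam - z)) = contour_integral \<gamma> (\<lambda>z. - (1 / (z - lam)))"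
    by (rule contour_integral_cong) (auto simp: divide_simps)
  moreover have "\<dots> = - (2 * pi * \<i>)"
    using half_gap_pos contour_integral_circlepath[of "half_gap G lam" lam]
    by (simp add: contour_integral_neg)
  ultimately show ?thesis using has_contour_integral_integral by fastforce
qed

text \<open>Let \<open>A\<close> be the operator with graph \<open>G\<close>. The equations \<open>(A - z) R(z) = I\<close> and \<open>R(z) (A - z) = I\<close>,
  paired with a vector, both have the form \<open>f z = b + z \<langle>R(z) x, y\<rangle>\<close>. Writing \<open>z\<close> as
  \<open>lam + (z - lam)\<close> turns them into the corresponding equations for the Riesz projection and the reduced
  resolvent. For the Riesz projection the contribution of \<open>(z - lam) \<langle>R(z) x, y\<rangle>\<close> is zero because the
  resolvent grows at most like \<open>1 / \<bar>Im z\<bar>\<close> and \<open>lam\<close> is real.\<close>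

lemma riesz_projection_integral:
  assumes f: "\<And>z. z \<notin> spectrum G \<Longrightarrow> f z = b + z * cinner (resolvent G z x) y"
  shows "(f has_contour_integral - (2 * pi * \<i>) * (lam * cinner (riesz_projection x) y)) \<gamma>"
proof -
  let ?h = "\<lambda>z. cinner (resolvent G z x) y"
  have "contour_integral \<gamma> (\<lambda>z. (z - lam) * ?h z) = 0"
  proof (rule contour_integral_circlepath_simple_pole[OF holomorphic_matrix_element])
    fix z assume "z \<in> ball lam (2 * half_gap G lam) - {lam}"
    then have "\<bar>Im z\<bar> * norm (resolvent G z x) \<le> norm x"
      using punctured_ball_resolvent_set by (intro resolvent_growth) blast
    moreover have "Im lam = 0" using lam_real by (simp add: complex_eq_iff)
    moreover have "\<bar>Im z\<bar> * cmod (?h z) \<le> \<bar>Im z\<bar> * (norm (resolvent G z x) * norm y)"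
      by (intro mult_left_mono norm_cinner_le) simp
    ultimately show "\<bar>Im (z - lam)\<bar> * cmod (?h z) \<le> norm x * norm y"
      using mult_right_mono[of _ "norm x" "norm y"] by (fastforce simp: mult.assoc)
  qed (use half_gap_pos in auto)
  then have 1: "((\<lambda>z. (z - lam) * ?h z) has_contour_integral 0) \<gamma>"
    using has_contour_integral_integral[OF matrix_element_integrable[of "\<lambda>z. z - lam" x y]]
    by (simp add: continuous_intros)
  have "((\<lambda>z. b) has_contour_integral b * pathfinish \<gamma> - b * pathstart \<gamma>) \<gamma>"
    by (rule contour_integral_primitive[where S = UNIV]) (auto intro!: derivative_eq_intros)
  then have 2: "((\<lambda>z. b) has_contour_integral 0) \<gamma>" by simp
  have "((\<lambda>z. b + ((z - lam) * ?h z + lam * ?h z)) has_contour_integral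
      0 + (0 + lam * (- (2 * pi * \<i>) * cinner (riesz_projection x) y))) \<gamma>"
    by (intro has_contour_integral_add 1 2 has_contour_integral_lmul cinner_riesz_projection)
  then have "(f has_contour_integral
      0 + (0 + lam * (- (2 * pi * \<i>) * cinner (riesz_projection x) y))) \<gamma>"
  proof (rule has_contour_integral_eq)
    fix z assume "z \<in> path_image \<gamma>"
    then have "z \<notin> spectrum G" using contour_resolvent_set by blast
    then show "b + ((z - lam) * ?h z + lam * ?h z) = f z" by (simp add: f algebra_simps)
  qed
  then show ?thesis by (simp add: mult.left_commute)
qed

lemma reduced_resolvent_integral:
  assumes f: "\<And>z. z \<notin> spectrum G \<Longrightarrow> f z = b + z * cinner (resolvent G z x) y"
  shows "((\<lambda>z. inverse (lam - z) * f z) has_contour_integral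
    - (2 * pi * \<i>) * (b + lam * cinner (reduced_resolvent x) y - cinner (riesz_projection x) y)) \<gamma>"
proof -
  let ?h = "\<lambda>z. cinner (resolvent G z x) y"
  have "((\<lambda>z. b * inverse (lam - z) + lam * (inverse (lam - z) * ?h z) - ?h z) has_contour_integral
      b * (- (2 * pi * \<i>)) + lam * (- (2 * pi * \<i>) * cinner (reduced_resolvent x) y)
      - (- (2 * pi * \<i>) * cinner (riesz_projection x) y)) \<gamma>"
    by (intro has_contour_integral_add has_contour_integral_diff has_contour_integral_lmul
        contour_integral_inverse cinner_reduced_resolvent cinner_riesz_projection)
  then have "((\<lambda>z. inverse (lam - z) * f z) has_contour_integral
      b * (- (2 * pi * \<i>)) + lam * (- (2 * pi * \<i>) * cinner (reduced_resolvent x) y)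
      - (- (2 * pi * \<i>) * cinner (riesz_projection x) y)) \<gamma>"
  proof (rule has_contour_integral_eq)
    fix z assume z: "z \<in> path_image \<gamma>"
    then have "z \<notin> spectrum G" using contour_resolvent_set by blast
    then have "inverse (lam - z) * f z = b * inverse (lam - z) + lam * (inverse (lam - z) * ?h z)
        - (inverse (lam - z) * (lam - z)) * ?h z"
      by (simp add: f algebra_simps)
    then show "b * inverse (lam - z) + lam * (inverse (lam - z) * ?h z) - ?h z
        = inverse (lam - z) * f z"
      using contour_nonzero[OF z] by simp
  qed
  then show ?thesis by (simp add: algebra_simps)
qed

lemma riesz_projection_eigenspace: "(riesz_projection x, lam *\<^sub>C riesz_projection x) \<in> G"
proof (rule weak_membership)
  fix y w assume yw: "(y, w) \<in> G"
  have "cinner (resolvent G z x) w = cinner x y + z * cinner (resolvent G z x) y"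
    if "z \<notin> spectrum G" for z
    using symmetric[OF resolvent_mem[OF that] yw, of x] by (simp add: cinner_simps)
  from has_contour_integral_unique[OF cinner_riesz_projection riesz_projection_integral[OF this]]
  show "cinner (riesz_projection x) w = cinner (lam *\<^sub>C riesz_projection x) y"
    by (simp add: cinner_simps)
qed

lemma reduced_resolvent_mem:
  "(reduced_resolvent x, x - riesz_projection x + lam *\<^sub>C reduced_resolvent x) \<in> G"
proof (rule weak_membership)
  fix y w assume yw: "(y, w) \<in> G"
  have "cinner (resolvent G z x) w = cinner x y + z * cinner (resolvent G z x) y"
    if "z \<notin> spectrum G" for z
    using symmetric[OF resolvent_mem[OF that] yw, of x] by (simp add: cinner_simps)
  from has_contour_integral_unique[OF cinner_reduced_resolvent reduced_resolvent_integral[OF this]]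
  show "cinner (reduced_resolvent x) w
      = cinner (x - riesz_projection x + lam *\<^sub>C reduced_resolvent x) y"
    by (simp add: cinner_simps)
qed

lemma reduced_resolvent_apply:
  assumes "(y, w) \<in> G"
  shows "reduced_resolvent w = y - riesz_projection y + lam *\<^sub>C reduced_resolvent y"
proof (rule cinner_ext)
  fix v
  have "cinner (resolvent G z w) v = cinner y v + z * cinner (resolvent G z y) v"
    if "z \<notin> spectrum G" for z
    by (simp add: resolvent_apply[OF that assms] cinner_simps)
  from has_contour_integral_unique[OF cinner_reduced_resolvent reduced_resolvent_integral[OF this]]
  show "cinner (reduced_resolvent w) v
      = cinner (y - riesz_projection y + lam *\<^sub>C reduced_resolvent y) v"
    by (simp add: cinner_simps)
qed

text \<open>On an eigenvector the resolvent is multiplication by \<open>1 / (lam - z)\<close>, and \<open>1 / (lam - z)\<^sup>2\<close> has a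
  primitive on the contour.\<close>

lemma reduced_resolvent_eigenspace:
  assumes u: "(u, lam *\<^sub>C u) \<in> G"
  shows "reduced_resolvent u = 0"
proof (rule cinner_ext)
  fix y
  have "((\<lambda>z. inverse (lam - z) * inverse (lam - z) * cinner u y) has_contour_integral 0 * cinner u y) \<gamma>"
    by (rule has_contour_integral_rmul[OF contour_integral_inverse_square])
  then have "((\<lambda>z. inverse (lam - z) * cinner (resolvent G z u) y) has_contour_integral 0 * cinner u y) \<gamma>"
  proof (rule has_contour_integral_eq)
    fix z assume z: "z \<in> path_image \<gamma>"
    then have zs: "z \<notin> spectrum G" using contour_resolvent_set by blast
    have "(u, (lam - z) *\<^sub>C u + z *\<^sub>C u) \<in> G" using u by (simp add: scaleC_add_left[symmetric])
    from scale_mem[OF this, of "inverse (lam - z)"]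
    have "resolvent G z u = inverse (lam - z) *\<^sub>C u"
      using contour_nonzero[OF z]
      by (intro resolvent_eqI[OF zs]) (simp add: scaleC_add_right scaleC_scaleC scaleC_one mult.commute)
    then show "inverse (lam - z) * inverse (lam - z) * cinner u y
        = inverse (lam - z) * cinner (resolvent G z u) y"
      by (simp add: cinner_simps)
  qed
  from has_contour_integral_unique[OF cinner_reduced_resolvent this]
  show "cinner (reduced_resolvent u) y = cinner 0 y" by simp
qed

lemma riesz_projection_eigenvector:
  "(u, lam *\<^sub>C u) \<in> G \<Longrightarrow> riesz_projection u = u"
  using reduced_resolvent_apply[of u "lam *\<^sub>C u"] scale_mem[of u "lam *\<^sub>C u" lam]
    reduced_resolvent_eigenspace[of u] reduced_resolvent_eigenspace[of "lam *\<^sub>C u"]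
  by simp

lemma riesz_projection_idem: "riesz_projection (riesz_projection x) = riesz_projection x"
  by (rule riesz_projection_eigenvector[OF riesz_projection_eigenspace])

lemma reduced_resolvent_riesz_projection: "reduced_resolvent (riesz_projection x) = 0"
  by (rule reduced_resolvent_eigenspace[OF riesz_projection_eigenspace])

lemma bounded_clinear_riesz_projection: "bounded_clinear riesz_projection"
proof -
  have "bounded_linear riesz_projection"
    unfolding riesz_projection_def[abs_def]
    by (rule bounded_linear_compose[OF bounded_linear_scaleC bounded_linear_op_contour_integral])
  moreover have "riesz_projection (c *\<^sub>C x) = c *\<^sub>C riesz_projection x" for c x
  proof (rule cinner_ext)
    fix y
    have "((\<lambda>z. cinner (resolvent G z (c *\<^sub>C x)) y) has_contour_integral
        c * (- (2 * pi * \<i>) * cinner (riesz_projection x) y)) \<gamma>"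
    proof (rule has_contour_integral_eq[OF has_contour_integral_lmul[OF cinner_riesz_projection]])
      fix z assume "z \<in> path_image \<gamma>"
      then have "z \<notin> spectrum G" using contour_resolvent_set by blast
      from bounded_clinear_scaleC[OF bounded_clinear_resolvent[OF this]]
      show "c * cinner (resolvent G z x) y = cinner (resolvent G z (c *\<^sub>C x)) y"
        by (simp add: cinner_simps)
    qed
    from has_contour_integral_unique[OF cinner_riesz_projection this]
    show "cinner (riesz_projection (c *\<^sub>C x)) y = cinner (c *\<^sub>C riesz_projection x) y"
      by (simp add: cinner_simps)
  qed
  ultimately show ?thesis by (simp add: bounded_clinear_def)
qed

lemma bounded_clinear_reduced_resolvent: "bounded_clinear reduced_resolvent"
proof -
  have "bounded_linear reduced_resolvent"
    unfolding reduced_resolvent_def[abs_def]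
    by (rule bounded_linear_compose[OF bounded_linear_scaleC bounded_linear_op_contour_integral])
  moreover have "reduced_resolvent (c *\<^sub>C x) = c *\<^sub>C reduced_resolvent x" for c x
  proof (rule cinner_ext)
    fix y
    have "((\<lambda>z. inverse (lam - z) * cinner (resolvent G z (c *\<^sub>C x)) y) has_contour_integral
        c * (- (2 * pi * \<i>) * cinner (reduced_resolvent x) y)) \<gamma>"
    proof (rule has_contour_integral_eq[OF has_contour_integral_lmul[OF cinner_reduced_resolvent]])
      fix z assume "z \<in> path_image \<gamma>"
      then have "z \<notin> spectrum G" using contour_resolvent_set by blast
      from bounded_clinear_scaleC[OF bounded_clinear_resolvent[OF this]]
      show "c * (inverse (lam - z) * cinner (resolvent G z x) y)
          = inverse (lam - z) * cinner (resolvent G z (c *\<^sub>C x)) y"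
        by (simp add: cinner_simps)
    qed
    from has_contour_integral_unique[OF cinner_reduced_resolvent this]
    show "cinner (reduced_resolvent (c *\<^sub>C x)) y = cinner (c *\<^sub>C reduced_resolvent x) y"
      by (simp add: cinner_simps)
  qed
  ultimately show ?thesis by (simp add: bounded_clinear_def)
qed

text \<open>The splitting \<open>x = P x + (A - lam) S x\<close> is orthogonal because \<open>lam\<close> is real and \<open>P x\<close> is
  an eigenvector; hence \<open>P\<close> is symmetric.\<close>

lemma eigenspace_orthogonal:
  assumes "(u, lam *\<^sub>C u) \<in> G"
  shows "cinner (x - riesz_projection x) u = 0"
  using symmetric[OF reduced_resolvent_mem[of x] assms] lam_real by (simp add: cinner_simps)

lemma riesz_projection_symmetric: "cinner (riesz_projection x) y = cinner x (riesz_projection y)"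
proof -
  have "cinner (x - riesz_projection x) (riesz_projection y) = 0"
    by (rule eigenspace_orthogonal[OF riesz_projection_eigenspace])
  moreover have "cinner (riesz_projection x) (y - riesz_projection y) = 0"
    using eigenspace_orthogonal[OF riesz_projection_eigenspace, of y x]
    by (metis cinner_commute complex_cnj_zero)
  ultimately show ?thesis by (simp add: cinner_simps)
qed

end

section \<open>Boundary triplets\<close>

lemma symplectic_form_Jop: "symplectic_form f g = cinner (Jop f) g"
  by (simp add: symplectic_form_def Jop_def cinner_prod_def cinner_minus_left)

lemma Jop_Jop: "Jop (Jop f) = - f"
  by (simp add: Jop_def prod_eq_iff)

lemma cinner_Jop: "cinner (Jop f) g = - cinner f (Jop g)"
  by (simp add: Jop_def cinner_prod_def cinner_simps)

lemma symplectic_form_commute: "symplectic_form f g = - cnj (symplectic_form g f)"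
  unfolding symplectic_form_Jop by (metis cinner_Jop cinner_commute)

context lagrangian_family
begin

lemma adjoint_add:
  "(u, w) \<in> adjoint_op A \<Longrightarrow> (v, y) \<in> adjoint_op A \<Longrightarrow> (u + v, w + y) \<in> adjoint_op A"
  by (fastforce simp: adjoint_op_def cinner_add_right)

lemma adjoint_scale: "(u, w) \<in> adjoint_op A \<Longrightarrow> (c *\<^sub>C u, c *\<^sub>C w) \<in> adjoint_op A"
  by (fastforce simp: adjoint_op_def cinner_scaleC_right)

lemma adjoint_zero: "(0, 0) \<in> adjoint_op A"
  by (simp add: adjoint_op_def)

lemma adjoint_unique:
  assumes "(u, w) \<in> adjoint_op A" "(u, w') \<in> adjoint_op A"
  shows "w = w'"
proof -
  let ?Z = "{x. cinner x (w - w') = 0}"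
  have "closed ?Z"
    by (intro closed_Collect_eq continuous_intros linear_continuous_on bounded_linear_cinner_left)
  moreover have "Domain A \<subseteq> ?Z"
    using assms by (fastforce simp: adjoint_op_def cinner_diff_right)
  ultimately have "closure (Domain A) \<subseteq> ?Z" by (rule closure_minimal[rotated])
  then have "w - w' \<in> ?Z" using A_op(2) by (auto simp: densely_defined_def)
  then show ?thesis by (simp add: cinner_self_eq_0)
qed

lemma op_apply_adjoint: "(u, w) \<in> adjoint_op A \<Longrightarrow> op_apply (adjoint_op A) u = w"
  unfolding op_apply_def using adjoint_unique by blast

lemma trace_add:
  "(u, w) \<in> adjoint_op A \<Longrightarrow> (v, y) \<in> adjoint_op A \<Longrightarrow> T (u + v) = T u + T v"
  using triplet unfolding boundary_triplet_def Let_def by (meson DomainI)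

lemma trace_scale: "(u, w) \<in> adjoint_op A \<Longrightarrow> T (c *\<^sub>C u) = c *\<^sub>C T u"
  using triplet unfolding boundary_triplet_def Let_def by (meson DomainI)

lemma trace_zero: "T 0 = 0"
  using trace_scale[OF adjoint_zero, of 0] by simp

lemma trace_surj:
  obtains u w where "(u, w) \<in> adjoint_op A" "T u = f"
proof -
  have "T ` Domain (adjoint_op A) = UNIV"
    using triplet unfolding boundary_triplet_def Let_def by meson
  then have "f \<in> T ` Domain (adjoint_op A)" by simp
  then show thesis using that by blast
qed

lemma green:
  assumes "(u, w) \<in> adjoint_op A" "(v, y) \<in> adjoint_op A"
  shows "cinner w v - cinner u y = symplectic_form (T u) (T v)"
proof -
  have "\<forall>u\<in>Domain (adjoint_op A). \<forall>v\<in>Domain (adjoint_op A).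
      cinner (op_apply (adjoint_op A) u) v - cinner u (op_apply (adjoint_op A) v)
          = cinner (\<Gamma>1 u) (\<Gamma>0 v) - cinner (\<Gamma>0 u) (\<Gamma>1 v)"
    using triplet unfolding boundary_triplet_def Let_def by meson
  then have "cinner (op_apply (adjoint_op A) u) v - cinner u (op_apply (adjoint_op A) v)
          = cinner (\<Gamma>1 u) (\<Gamma>0 v) - cinner (\<Gamma>0 u) (\<Gamma>1 v)"
    using assms by (meson DomainI)
  then show ?thesis
    by (simp add: op_apply_adjoint[OF assms(1)] op_apply_adjoint[OF assms(2)]
        symplectic_form_def trace_map_def)
qed

lemma trace_bound:
  obtains K where "0 \<le> K"
    "\<And>u w. (u, w) \<in> adjoint_op A \<Longrightarrow> norm (T u) \<le> K * (norm u + norm w)"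
proof -
  obtain K where K: "\<And>u. u \<in> Domain (adjoint_op A) \<Longrightarrow> norm (T u) \<le> K * sqrt (Re (graph_cinner A u u))"
    using triplet unfolding boundary_triplet_def Let_def by meson
  have "norm (T u) \<le> \<bar>K\<bar> * (norm u + norm w)" if uw: "(u, w) \<in> adjoint_op A" for u w
  proof -
    have "Re (graph_cinner A u u) = (norm u)\<^sup>2 + (norm w)\<^sup>2"
      by (simp add: graph_cinner_def op_apply_adjoint[OF uw] cinner_self flip: of_real_power)
    then have "norm (T u) \<le> K * sqrt ((norm u)\<^sup>2 + (norm w)\<^sup>2)"
      using K[of u] uw by auto
    also have "\<dots> \<le> \<bar>K\<bar> * sqrt ((norm u)\<^sup>2 + (norm w)\<^sup>2)"
      by (intro mult_right_mono) auto
    also have "\<dots> \<le> \<bar>K\<bar> * (norm u + norm w)"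
      by (intro mult_left_mono sqrt_sum_squares_le_sum) auto
    finally show ?thesis .
  qed
  then show thesis using that[of "\<bar>K\<bar>"] by simp
qed

text \<open>\<open>T\<close> is bounded for the graph norm only, so boundedness of \<open>T F\<close> requires control of \<open>A\<^sup>* F\<close>
  as well.\<close>

lemma bounded_clinear_trace:
  assumes F: "bounded_clinear F" and H: "bounded_clinear H"
    and FH: "\<And>x. (F x, H x) \<in> adjoint_op A"
  shows "bounded_clinear (\<lambda>x. T (F x))"
proof -
  obtain K where K: "0 \<le> K" "\<And>u w. (u, w) \<in> adjoint_op A \<Longrightarrow> norm (T u) \<le> K * (norm u + norm w)"
    using trace_bound by blast
  obtain KF where KF: "\<And>x. norm (F x) \<le> KF * norm x" using F bounded_clinear_bound by blast
  obtain KH where KH: "\<And>x. norm (H x) \<le> KH * norm x" using H bounded_clinear_bound by blast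
  have "norm (T (F x)) \<le> norm x * (K * (KF + KH))" for x
  proof -
    have "norm (T (F x)) \<le> K * (norm (F x) + norm (H x))" by (rule K(2)[OF FH])
    also have "\<dots> \<le> K * (KF * norm x + KH * norm x)" by (intro mult_left_mono add_mono KF KH K(1))
    finally show ?thesis by (simp add: algebra_simps)
  qed
  then show ?thesis
    by (intro bounded_clinearI[where K = "K * (KF + KH)"])
      (simp_all add: bounded_clinear_add[OF F] bounded_clinear_scaleC[OF F] trace_add[OF FH FH]
        trace_scale[OF FH])
qed

lemma ext_iff: "(u, w) \<in> ext t \<longleftrightarrow> (u, w) \<in> adjoint_op A \<and> T u \<in> range (Q t)"
  by (simp add: ext_def extension_of_def)

text \<open>Green's formula makes \<open>T v\<close> symplectically orthogonal to everything when \<open>v\<close> is in the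
  domain of \<open>A\<close>.\<close>

lemma trace_minimal_domain:
  assumes "(v, y) \<in> A"
  shows "T v = 0"
proof -
  have vy: "(v, y) \<in> adjoint_op A" using assms A_op(3) by (auto simp: symmetric_op_def)
  have "symplectic_form f (T v) = 0" for f
  proof -
    obtain u w where uw: "(u, w) \<in> adjoint_op A" "T u = f" by (rule trace_surj)
    have "cinner y u = cinner v w" using uw(1) assms by (auto simp: adjoint_op_def)
    then have "cinner w v = cinner u y" by (metis cinner_commute)
    then show ?thesis using green[OF uw(1) vy] uw(2) by simp
  qed
  from this[of "Jop (T v)"] show ?thesis
    by (simp add: symplectic_form_Jop Jop_Jop cinner_minus_left cinner_self_eq_0)
qed

lemma lagrangian_subspace: "t \<in> {0..1} \<Longrightarrow> complex_vector.subspace (range (Q t))"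
  using Q_lagrangian[of t] unfolding lagrangian_def by blast

lemma lagrangian_mem_iff:
  "t \<in> {0..1} \<Longrightarrow> f \<in> range (Q t) \<longleftrightarrow> (\<forall>g\<in>range (Q t). symplectic_form f g = 0)"
  using Q_lagrangian[of t] unfolding lagrangian_def by blast

text \<open>The extension contains \<open>A\<close>, so its adjoint is a restriction of \<open>A\<^sup>*\<close>. By Green's formula the
  boundary values allowed in the adjoint form the symplectic annihilator of the range of \<open>Q t\<close>,
  which is that range itself.\<close>

lemma selfadjoint_ext:
  assumes t: "t \<in> {0..1}"
  shows "selfadjoint_op (ext t)"
proof
  note sub = lagrangian_subspace[OF t]
  have "complex_vector.subspace (ext t)"
  proof (rule complex_vector.subspaceI)
    show "0 \<in> ext t"
      unfolding zero_prod_def[where 'a = 'h and 'b = 'h]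
      using adjoint_zero complex_vector.subspace_0[OF sub] by (simp add: ext_iff trace_zero)
    fix p q :: "'h \<times> 'h" and c :: complex
    assume pt: "p \<in> ext t"
    obtain x y where p: "p = (x, y)" by (cases p)
    have xy: "(x, y) \<in> adjoint_op A" "T x \<in> range (Q t)" using pt p by (simp_all add: ext_iff)
    show "c *\<^sub>C p \<in> ext t"
      using adjoint_scale[OF xy(1)] complex_vector.subspace_scale[OF sub xy(2)]
      by (simp only: p scaleC_prod_def fst_conv snd_conv ext_iff trace_scale[OF xy(1)] simp_thms)
    assume qt: "q \<in> ext t"
    obtain v w where q: "q = (v, w)" by (cases q)
    have vw: "(v, w) \<in> adjoint_op A" "T v \<in> range (Q t)" using qt q by (simp_all add: ext_iff)
    show "p + q \<in> ext t"
      using adjoint_add[OF xy(1) vw(1)] complex_vector.subspace_add[OF sub xy(2) vw(2)]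
      by (simp only: p q add_Pair ext_iff trace_add[OF xy(1) vw(1)] simp_thms)
  qed
  moreover have "single_valued (ext t)"
    using adjoint_unique by (auto simp: single_valued_def ext_iff)
  ultimately show "linear_op (ext t)" by (simp add: linear_op_def)
  show "adjoint_op (ext t) = ext t"
  proof (rule set_eqI)
    fix p :: "'h \<times> 'h"
    obtain v w where p: "p = (v, w)" by (cases p)
    have "(v, w) \<in> adjoint_op (ext t)" if vw: "(v, w) \<in> ext t"
      unfolding adjoint_op_def
    proof (clarify)
      fix x y assume xy: "(x, y) \<in> ext t"
      then have "symplectic_form (T x) (T v) = 0"
        using vw lagrangian_mem_iff[OF t, of "T x"] unfolding ext_iff by blast
      then show "cinner y v = cinner x w"
        using green[of x y v w] xy vw by (simp add: ext_iff)
    qed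
    moreover have "(v, w) \<in> ext t" if vw: "(v, w) \<in> adjoint_op (ext t)"
    proof -
      have "(x, y) \<in> ext t" if "(x, y) \<in> A" for x y
        using that A_op(3) trace_minimal_domain[OF that] complex_vector.subspace_0[OF sub]
        by (auto simp: ext_iff symmetric_op_def)
      then have vwA: "(v, w) \<in> adjoint_op A" using vw by (fastforce simp: adjoint_op_def)
      have "symplectic_form (T v) f = 0" if f: "f \<in> range (Q t)" for f
      proof -
        obtain x y where xy: "(x, y) \<in> adjoint_op A" "T x = f" by (rule trace_surj)
        then have "(x, y) \<in> ext t" using f by (simp add: ext_iff)
        then have "cinner y v = cinner x w" using vw by (fastforce simp: adjoint_op_def)
        then have "symplectic_form f (T v) = 0" using green[OF xy(1) vwA] xy(2) by simp
        then show ?thesis using symplectic_form_commute[of "T v" f] by simp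
      qed
      then show ?thesis using vwA lagrangian_mem_iff[OF t, of "T v"] unfolding ext_iff by blast
    qed
    ultimately show "p \<in> adjoint_op (ext t) \<longleftrightarrow> p \<in> ext t" using p by blast
  qed
qed

sublocale E: isolated_eigenvalue "ext t0" lam
proof -
  interpret selfadjoint_op "ext t0" by (rule selfadjoint_ext[OF t0])
  show "isolated_eigenvalue (ext t0) lam"
  proof
    show "\<exists>\<epsilon>>0. ball lam \<epsilon> \<inter> spectrum (ext t0) = {lam}"
      using lam_isolated by (simp add: ext_def)
    show "\<exists>u. u \<noteq> 0 \<and> (u, lam *\<^sub>C u) \<in> ext t0"
    proof (rule ccontr)
      assume "\<nexists>u. u \<noteq> 0 \<and> (u, lam *\<^sub>C u) \<in> ext t0"
      then have "eigenspace (ext t0) lam \<subseteq> {0}" by (auto simp: eigenspace_def)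
      then have "complex_vector.span (eigenspace (ext t0) lam) \<subseteq> complex_vector.span {0}"
        by (rule complex_vector.span_mono)
      moreover have "complex_vector.span {0} = complex_vector.span ({} :: 'h set)"
        by (rule complex_vector.span_insert_0)
      moreover have "complex_vector.span {} \<subseteq> complex_vector.span (eigenspace (ext t0) lam)"
        by (rule complex_vector.span_mono) simp
      ultimately have "complex_vector.span (eigenspace (ext t0) lam) = complex_vector.span {}"
        by (simp only: subset_antisym)
      then have "complex_vector.dim (eigenspace (ext t0) lam) = card ({} :: 'h set)"
        by (rule complex_vector.dim_eq_card[OF sym complex_vector.independent_empty])
      then show False using lam_multiplicity m_pos by (simp add: ext_def)
    qed
  qed
qed

lemma P_eq: "P t0 = E.riesz_projection"
  by (rule HOL.ext) (simp add: P_def E.riesz_projection_def contour_def)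

lemma S_eq: "S = E.reduced_resolvent"
  by (rule HOL.ext) (simp add: S_def E.reduced_resolvent_def contour_def)

lemma P_mem: "(P t0 x, lam *\<^sub>C P t0 x) \<in> ext t0"
  unfolding P_eq by (rule E.riesz_projection_eigenspace)

lemma S_mem: "(S x, x - P t0 x + lam *\<^sub>C S x) \<in> ext t0"
  unfolding P_eq S_eq by (rule E.reduced_resolvent_mem)

lemma bounded_clinear_P: "bounded_clinear (P t0)"
  unfolding P_eq by (rule E.bounded_clinear_riesz_projection)

lemma bounded_clinear_S: "bounded_clinear S"
  unfolding S_eq by (rule E.bounded_clinear_reduced_resolvent)

lemma bounded_clinear_TP: "bounded_clinear (T \<circ> P t0)"
  unfolding o_def
  using P_mem
  by (intro bounded_clinear_trace[where H = "\<lambda>x. lam *\<^sub>C P t0 x"] bounded_clinear_P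
      bounded_clinear_scaled) (auto simp: ext_iff)

lemma bounded_clinear_TS: "bounded_clinear (T \<circ> S)"
  unfolding o_def
proof (rule bounded_clinear_trace[where H = "\<lambda>x. (x - P t0 x) + lam *\<^sub>C S x"])
  show "bounded_clinear (\<lambda>x. (x - P t0 x) + lam *\<^sub>C S x)"
    by (intro bounded_clinear_sum bounded_clinear_difference bounded_clinear_ident
        bounded_clinear_P bounded_clinear_scaled bounded_clinear_S)
  show "(S x, (x - P t0 x) + lam *\<^sub>C S x) \<in> adjoint_op A" for x
    using S_mem[of x] by (simp add: ext_iff)
qed (rule bounded_clinear_S)

lemma trace_S_apply:
  assumes "(y, v) \<in> ext t0"
  shows "T (S v) = T y - T (P t0 y) + lam *\<^sub>C T (S y)"
proof -
  have y: "(y, v) \<in> adjoint_op A" using assms by (simp add: ext_iff)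
  have p: "((-1) *\<^sub>C P t0 y, (-1) *\<^sub>C lam *\<^sub>C P t0 y) \<in> adjoint_op A"
    using P_mem by (intro adjoint_scale) (simp add: ext_iff)
  have s: "(lam *\<^sub>C S y, lam *\<^sub>C (y - P t0 y + lam *\<^sub>C S y)) \<in> adjoint_op A"
    using S_mem by (intro adjoint_scale) (simp add: ext_iff)
  have "S v = (y + (-1) *\<^sub>C P t0 y) + lam *\<^sub>C S y"
    using E.reduced_resolvent_apply[OF assms] by (simp add: P_eq S_eq)
  then have "T (S v) = T y + T ((-1) *\<^sub>C P t0 y) + T (lam *\<^sub>C S y)"
    by (simp only: trace_add[OF adjoint_add[OF y p] s] trace_add[OF y p])
  then show ?thesis
    using trace_scale[of "P t0 y" "lam *\<^sub>C P t0 y" "-1"] trace_scale[of "S y" _ lam] P_mem[of y] S_mem[of y]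
    by (auto simp: ext_iff)
qed

lemma cinner_cadjoint_TS:
  assumes "(y, v) \<in> ext t0"
  shows "cinner v (cadjoint (T \<circ> S) g) = cinner (T y) g - cinner y (cadjoint (T \<circ> P t0) g)
    + lam * cinner y (cadjoint (T \<circ> S) g)"
  by (simp add: cinner_cadjoint[OF bounded_clinear_TS, symmetric]
      cinner_cadjoint[OF bounded_clinear_TP, symmetric] trace_S_apply[OF assms] cinner_simps)

text \<open>Testing \<open>(T S)\<^sup>* g\<close> against the range of
  \<open>A - lam\<close> replaces \<open>S (A - lam)\<close> by \<open>I - P\<close>, and \<open>T\<close> vanishes on the domain of \<open>A\<close>.\<close>

lemma cadjoint_TS_mem:
  "(cadjoint (T \<circ> S) g, lam *\<^sub>C cadjoint (T \<circ> S) g - cadjoint (T \<circ> P t0) g) \<in> adjoint_op A"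
  unfolding adjoint_op_def
proof (clarify)
  fix x y assume xy: "(x, y) \<in> A"
  have "(x, y) \<in> ext t0"
    using xy A_op(3) trace_minimal_domain[OF xy] complex_vector.subspace_0[OF lagrangian_subspace[OF t0]]
    by (auto simp: ext_iff symmetric_op_def)
  from cinner_cadjoint_TS[OF this, of g] trace_minimal_domain[OF xy]
  show "cinner y (cadjoint (T \<circ> S) g)
      = cinner x (lam *\<^sub>C cadjoint (T \<circ> S) g - cadjoint (T \<circ> P t0) g)"
    by (simp add: cinner_simps E.lam_real)
qed

lemma bounded_clinear_T_cadjoint_TS: "bounded_clinear (\<lambda>g. T (cadjoint (T \<circ> S) g))"
  by (intro bounded_clinear_trace[OF _ _ cadjoint_TS_mem] bounded_clinear_difference
      bounded_clinear_scaled
      bounded_clinear_cadjoint bounded_clinear_TS bounded_clinear_TP)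

text \<open>The boundary values of \<open>(T S)\<^sup>* g\<close> are determined, modulo the Lagrangian subspace itself,
  by \<open>g\<close>.\<close>

lemma boundary_value_cadjoint_TS:
  assumes f: "f \<in> range (Q t0)"
  shows "cinner (Jop (T (cadjoint (T \<circ> S) g))) f = - cinner g f"
proof -
  let ?w = "cadjoint (T \<circ> S) g" and ?p = "cadjoint (T \<circ> P t0) g"
  obtain y v where yv: "(y, v) \<in> adjoint_op A" "T y = f" by (rule trace_surj)
  then have ext: "(y, v) \<in> ext t0" using f by (simp add: ext_iff)
  have "cinner ?w v = cinner g f - cinner ?p y + lam * cinner ?w y"
    using arg_cong[OF cinner_cadjoint_TS[OF ext, of g], of cnj] yv(2)
    by (simp add: cinner_commute[symmetric] E.lam_real)
  then show ?thesis
    using green[OF cadjoint_TS_mem yv(1), of g] yv(2)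
    by (simp add: symplectic_form_Jop cinner_simps)
qed

lemma P_cadjoint_TS: "P t0 (cadjoint (T \<circ> S) g) = 0"
proof (rule cinner_ext)
  fix x
  have "cinner (P t0 (cadjoint (T \<circ> S) g)) x = cinner (cadjoint (T \<circ> S) g) (P t0 x)"
    unfolding P_eq by (rule E.riesz_projection_symmetric)
  also have "\<dots> = cinner g (T (S (P t0 x)))"
    by (simp add: cinner_cadjoint_left[OF bounded_clinear_TS])
  also have "S (P t0 x) = 0"
    unfolding P_eq S_eq by (rule E.reduced_resolvent_riesz_projection)
  finally show "cinner (P t0 (cadjoint (T \<circ> S) g)) x = cinner 0 x"
    by (simp only: trace_zero cinner_zero_left cinner_zero_right)
qed

text \<open>By Green's formula this is the statement that \<open>\<langle>A\<^sup>* w, w\<rangle>\<close> is real for \<open>w = (T S)\<^sup>* g\<close>. The only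
  part of \<open>A\<^sup>* w\<close> that could spoil it is \<open>(T P)\<^sup>* g\<close>, which is orthogonal to \<open>w\<close> as \<open>P w = 0\<close>.\<close>

lemma cadjoint_TS_isotropic:
  "symplectic_form (T (cadjoint (T \<circ> S) g)) (T (cadjoint (T \<circ> S) g)) = 0"
proof -
  let ?w = "cadjoint (T \<circ> S) g" and ?p = "cadjoint (T \<circ> P t0) g"
  have "cinner ?p ?w = 0"
    by (simp add: cinner_cadjoint_left[OF bounded_clinear_TP] P_cadjoint_TS trace_zero)
  then have "cinner ?p ?w = 0" "cinner ?w ?p = 0"
    by (auto, metis cinner_commute complex_cnj_zero)
  then show ?thesis
    using green[OF cadjoint_TS_mem cadjoint_TS_mem, of g g] by (simp add: cinner_simps E.lam_real)
qed

lemma cinner_Wdot: "cinner (Wdot x) y = cinner (Jop (Q1 (T (P t0 x)))) (T (P t0 y))"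
  by (simp add: Wdot_def cinner_cadjoint_left[OF bounded_clinear_TP])

lemma cinner_Wddot:
  "cinner (Wddot x) y = cinner (Jop (Q2 (T (P t0 x)))) (T (P t0 y))
    - 2 * cinner (Q1 (Jop (T (P t0 x)))) (T (cadjoint (T \<circ> S) (Q1 (Jop (T (P t0 y))))))"
proof -
  have "bounded_clinear (\<lambda>y. T (P t0 y))" by (rule bounded_clinear_TP[unfolded o_def])
  then have "bounded_clinear (\<lambda>y. T (cadjoint (T \<circ> S) (Q1 (Jop (T (P t0 y))))))"
    by (intro bounded_clinear_compose[OF bounded_clinear_T_cadjoint_TS]
        bounded_clinear_compose[OF Q12_bounded(1)] bounded_clinear_compose[OF bounded_clinear_Jop])
  from cinner_cadjoint_left[OF this] show ?thesis
    by (simp add: Wddot_def cinner_simps cinner_cadjoint_left[OF bounded_clinear_TP])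
qed

lemma bounded_clinear_Wdot: "bounded_clinear Wdot"
proof -
  have "bounded_clinear (\<lambda>y. T (P t0 y))" by (rule bounded_clinear_TP[unfolded o_def])
  then show ?thesis
    unfolding Wdot_def[abs_def]
    by (intro bounded_clinear_compose[OF bounded_clinear_cadjoint[OF bounded_clinear_TP]]
        bounded_clinear_compose[OF bounded_clinear_Jop] bounded_clinear_compose[OF Q12_bounded(1)])
qed

lemma P_idem: "P t0 (P t0 x) = P t0 x"
  unfolding P_eq by (rule E.riesz_projection_idem)

text \<open>The eigenspaces of \<open>Wdot\<close> in the range of \<open>P t0\<close> are closed, so \<open>eigenproj\<close> really is the
  orthogonal projection onto them.\<close>

lemma eigenproj:
  shows "P t0 (eigenproj z x) = eigenproj z x"
    and "Wdot (eigenproj z x) = z *\<^sub>C eigenproj z x"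
    and "P t0 y = y \<Longrightarrow> Wdot y = z *\<^sub>C y \<Longrightarrow> cinner (x - eigenproj z x) y = 0"
proof -
  let ?M = "{x \<in> range (P t0). Wdot x = z *\<^sub>C x}"
  have M: "?M = {x. P t0 x = x} \<inter> {x. Wdot x = z *\<^sub>C x}"
    using P_idem by (auto, metis rangeI)
  have "complex_vector.subspace ?M"
    unfolding M complex_vector.subspace_def
    using bounded_clinear_P bounded_clinear_Wdot
    by (simp add: bounded_clinear_zero bounded_clinear_add bounded_clinear_scaleC
        scaleC_add_right scaleC_scaleC mult.commute)
  moreover have "closed ?M"
    unfolding M
    by (intro closed_Int closed_Collect_eq linear_continuous_on continuous_on_id
        bounded_clinear_bounded_linear bounded_clinear_P bounded_clinear_Wdot bounded_linear_scaleC)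
  ultimately have *: "eigenproj z x \<in> ?M" "\<And>y. y \<in> ?M \<Longrightarrow> cinner (x - eigenproj z x) y = 0"
    unfolding eigenproj_def by (rule proj_onto)+
  show "P t0 (eigenproj z x) = eigenproj z x" "Wdot (eigenproj z x) = z *\<^sub>C eigenproj z x"
    using *(1) unfolding M by auto
  show "P t0 y = y \<Longrightarrow> Wdot y = z *\<^sub>C y \<Longrightarrow> cinner (x - eigenproj z x) y = 0"
    using *(2)[of y] unfolding M by auto
qed

end

context eigenvalue_curves
begin

text \<open>Each \<open>u i k\<close> is a unit vector in the range of the projection \<open>eigenproj (\<mu> i)\<close>, so compressing
  \<open>Wddot\<close> by this projection does not change its quadratic form at \<open>u i k\<close>.\<close>

lemma curve_coefficients:
  assumes i: "i \<in> {1..m'}" and k: "k \<in> {1..mi i}"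
  defines "f \<equiv> T (u i k)"
  shows "f \<in> range (Q t0)"
    and "\<mu> i = cinner (Jop (Q1 f)) f"
    and "\<nu> i k = cinner (Jop (Q2 f)) f
      - 2 * cinner (Q1 (Jop f)) (T (cadjoint (T \<circ> S) (Q1 (Jop f))))"
proof -
  obtain x where x: "u i k = eigenproj (\<mu> i) x" using u_range[OF i k] by blast
  have Pu: "P t0 (u i k) = u i k" and Wu: "Wdot (u i k) = \<mu> i *\<^sub>C u i k"
    unfolding x by (rule eigenproj)+
  have one: "cinner (u i k) (u i k) = 1" using u_orthonormal[OF i k i k] by simp
  show "f \<in> range (Q t0)" using P_mem[of "u i k"] by (simp add: ext_iff Pu f_def)
  show "\<mu> i = cinner (Jop (Q1 f)) f"
    using cinner_Wdot[of "u i k" "u i k"] by (simp add: Wu Pu one cinner_scaleC_left f_def)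
  let ?e = "eigenproj (\<mu> i)"
  have ou: "cinner (v - ?e v) (u i k) = 0" for v by (rule eigenproj(3)[OF Pu Wu])
  have "u i k - ?e (u i k) = 0"
  proof -
    have "cinner (u i k - ?e (u i k)) (?e (u i k)) = 0" by (intro eigenproj)
    with ou[of "u i k"] have "cinner (u i k - ?e (u i k)) (u i k - ?e (u i k)) = 0"
      by (simp only: cinner_diff_right diff_self)
    then show ?thesis by (simp only: cinner_self_eq_0)
  qed
  then have "?e (Wddot (u i k)) = \<nu> i k *\<^sub>C u i k" using u_eigenvector[OF i k] by simp
  with ou[of "Wddot (u i k)"] have "cinner (Wddot (u i k)) (u i k) = \<nu> i k"
    by (simp add: cinner_diff_left cinner_scaleC_left one)
  then show "\<nu> i k = cinner (Jop (Q2 f)) f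
      - 2 * cinner (Q1 (Jop f)) (T (cadjoint (T \<circ> S) (Q1 (Jop f))))"
    using cinner_Wddot[of "u i k" "u i k"] by (simp add: Pu f_def)
qed

end

section \<open>Second-order expansions\<close>

text \<open>The pointwise counterpart of \<open>expansion2\<close> for vectors, with the same normalisation: \<open>v2\<close> is the
  second derivative and not the second Taylor coefficient.\<close>

definition has_expansion2 ::
  "(real \<Rightarrow> 'a::real_normed_vector) \<Rightarrow> 'a \<Rightarrow> 'a \<Rightarrow> 'a \<Rightarrow> real \<Rightarrow> bool" where
  "has_expansion2 v v0 v1 v2 t0 \<longleftrightarrow>
     ((\<lambda>t. (v t - (v0 + (t - t0) *\<^sub>R v1 + ((t - t0)\<^sup>2 / 2) *\<^sub>R v2)) /\<^sub>R (t - t0)\<^sup>2) \<longlongrightarrow> 0)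
       (at t0 within {0..1})"

lemma at_within_unit_interval_nontrivial: "t0 \<in> {0..1} \<Longrightarrow> at t0 within {0..1::real} \<noteq> bot"
  using connected_imp_perfect[of "{0..1::real}" t0] by (auto simp: trivial_limit_within)

lemma tendsto_diff_at_within: "((\<lambda>t. t - t0) \<longlongrightarrow> 0) (at t0 within X)" for t0 :: real
  by (rule tendsto_eq_intros refl | simp)+

lemma eventually_unit_interval:
  "\<forall>\<^sub>F t in at t0 within {0..1::real}. t \<in> {0..1} \<and> t \<noteq> t0"
  by (simp add: eventually_at_filter)

lemma has_expansion2_cong:
  assumes "\<And>t. t \<in> {0..1} \<Longrightarrow> v t = w t"
  shows "has_expansion2 v v0 v1 v2 t0 \<longleftrightarrow> has_expansion2 w v0 v1 v2 t0"
  unfolding has_expansion2_def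
  by (intro tendsto_cong eventually_mono[OF eventually_unit_interval]) (simp add: assms)

lemma has_expansion2_const: "has_expansion2 (\<lambda>t. c) c 0 0 t0"
  by (simp add: has_expansion2_def)

lemma has_expansion2_add:
  assumes "has_expansion2 v v0 v1 v2 t0" "has_expansion2 w w0 w1 w2 t0"
  shows "has_expansion2 (\<lambda>t. v t + w t) (v0 + w0) (v1 + w1) (v2 + w2) t0"
  using tendsto_add[OF assms[unfolded has_expansion2_def]]
  unfolding has_expansion2_def by (simp add: algebra_simps)

lemma has_expansion2_linear:
  assumes "bounded_linear f" "has_expansion2 v v0 v1 v2 t0"
  shows "has_expansion2 (\<lambda>t. f (v t)) (f v0) (f v1) (f v2) t0"
proof -
  interpret bounded_linear f by fact
  show ?thesis
    using tendsto[OF assms(2)[unfolded has_expansion2_def]]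
    unfolding has_expansion2_def by (simp add: zero diff add scaleR)
qed

lemma has_expansion2_diff:
  assumes "has_expansion2 v v0 v1 v2 t0" "has_expansion2 w w0 w1 w2 t0"
  shows "has_expansion2 (\<lambda>t. v t - w t) (v0 - w0) (v1 - w1) (v2 - w2) t0"
  using has_expansion2_add[OF assms(1)
    has_expansion2_linear[OF bounded_linear_minus[OF bounded_linear_ident] assms(2)]]
  by simp

lemma has_expansion2_zero_unique:
  assumes t0: "t0 \<in> {0..1}" and z: "has_expansion2 (\<lambda>t. 0) v0 v1 v2 t0"
  shows "v0 = 0" "v1 = 0" "v2 = 0"
proof -
  let ?F = "at t0 within {0..1::real}"
  note nb = at_within_unit_interval_nontrivial[OF t0]
  note s = tendsto_diff_at_within[of t0 "{0..1}"]
  define g where "g t = (v0 + (t - t0) *\<^sub>R v1 + ((t - t0)\<^sup>2 / 2) *\<^sub>R v2) /\<^sub>R (t - t0)\<^sup>2" for t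
  have g: "(g \<longlongrightarrow> 0) ?F"
    using tendsto_minus[OF z[unfolded has_expansion2_def]] 
    by (simp only: g_def[abs_def] diff_0 scaleR_minus_right minus_minus minus_zero)
  have lim0: "((\<lambda>t. v0 + (t - t0) *\<^sub>R v1 + ((t - t0)\<^sup>2 / 2) *\<^sub>R v2) \<longlongrightarrow> v0) ?F"
    by (rule tendsto_eq_intros s refl | simp)+
  have "((\<lambda>t. (t - t0)\<^sup>2 *\<^sub>R g t) \<longlongrightarrow> 0\<^sup>2 *\<^sub>R 0) ?F"
    by (intro tendsto_intros s g)
  then have "((\<lambda>t. v0 + (t - t0) *\<^sub>R v1 + ((t - t0)\<^sup>2 / 2) *\<^sub>R v2) \<longlongrightarrow> 0\<^sup>2 *\<^sub>R 0) ?F"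
    by (rule tendsto_cong[THEN iffD1, rotated])
      (auto simp: g_def intro: eventually_mono[OF eventually_unit_interval])
  from tendsto_unique[OF nb lim0 this] show v0: "v0 = 0" by simp
  have lim1: "((\<lambda>t. v1 + ((t - t0) / 2) *\<^sub>R v2) \<longlongrightarrow> v1) ?F"
    by (rule tendsto_eq_intros s refl | simp)+
  have eq1: "(t - t0) *\<^sub>R g t = v1 + ((t - t0) / 2) *\<^sub>R v2" if "t \<noteq> t0" for t
  proof -
    have s: "s * (inverse (s\<^sup>2) * s) = 1" "s * (inverse (s\<^sup>2) * (s\<^sup>2 / 2)) = s / 2"
      if "s \<noteq> 0" for s :: real
      using that by (simp_all add: power2_eq_square field_simps)
    have "t - t0 \<noteq> 0" using that by simp
    from s[OF this] show ?thesis
      by (simp only: g_def v0 add_0_left scaleR_add_right scaleR_scaleR mult.assoc scaleR_one)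
  qed
  have "((\<lambda>t. (t - t0) *\<^sub>R g t) \<longlongrightarrow> 0 *\<^sub>R 0) ?F"
    by (intro tendsto_intros s g)
  then have "((\<lambda>t. v1 + ((t - t0) / 2) *\<^sub>R v2) \<longlongrightarrow> 0 *\<^sub>R 0) ?F"
    by (rule tendsto_cong[THEN iffD1, rotated])
      (auto simp: eq1 intro: eventually_mono[OF eventually_unit_interval])
  from tendsto_unique[OF nb lim1 this] show v1: "v1 = 0" by simp
  have "((\<lambda>t. (1/2) *\<^sub>R v2) \<longlongrightarrow> 0) ?F"
    using g by (rule tendsto_cong[THEN iffD1, rotated])
      (auto simp: g_def v0 v1 intro: eventually_mono[OF eventually_unit_interval])
  from tendsto_unique[OF nb tendsto_const this] show "v2 = 0" by simp
qed

lemma has_expansion2_unique: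
  assumes "t0 \<in> {0..1}" "has_expansion2 v v0 v1 v2 t0" "has_expansion2 w w0 w1 w2 t0"
    and "\<And>t. t \<in> {0..1} \<Longrightarrow> v t = w t"
  shows "v0 = w0" "v1 = w1" "v2 = w2"
proof -
  have "has_expansion2 (\<lambda>t. v t - w t) (v0 - w0) (v1 - w1) (v2 - w2) t0"
    by (rule has_expansion2_diff[OF assms(2,3)])
  then have "has_expansion2 (\<lambda>t. 0) (v0 - w0) (v1 - w1) (v2 - w2) t0"
    using has_expansion2_cong[of "\<lambda>t. v t - w t" "\<lambda>t. 0"] assms(4) by simp
  from has_expansion2_zero_unique[OF assms(1) this] show "v0 = w0" "v1 = w1" "v2 = w2" by auto
qed

lemma has_expansion2_tendsto:
  assumes "has_expansion2 v v0 v1 v2 t0"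
  shows "(v \<longlongrightarrow> v0) (at t0 within {0..1})"
proof -
  let ?F = "at t0 within {0..1::real}"
  note s = tendsto_diff_at_within[of t0 "{0..1}"]
  define g where "g t = (v t - (v0 + (t - t0) *\<^sub>R v1 + ((t - t0)\<^sup>2 / 2) *\<^sub>R v2)) /\<^sub>R (t - t0)\<^sup>2" for t
  have g: "(g \<longlongrightarrow> 0) ?F" using assms by (simp add: has_expansion2_def g_def[abs_def])
  have "((\<lambda>t. v0 + (t - t0) *\<^sub>R v1 + ((t - t0)\<^sup>2 / 2) *\<^sub>R v2 + (t - t0)\<^sup>2 *\<^sub>R g t) \<longlongrightarrow> v0) ?F"
    by (rule tendsto_eq_intros s g refl | simp)+
  then show ?thesis
    by (rule tendsto_cong[THEN iffD1, rotated])
      (auto simp: g_def intro: eventually_mono[OF eventually_unit_interval])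
qed

lemma has_expansion2_shift:
  assumes "has_expansion2 v v0 v1 v2 t0"
  shows "has_expansion2 (\<lambda>t. (t - t0) *\<^sub>R v t) 0 v0 (2 *\<^sub>R v1) t0"
proof -
  let ?F = "at t0 within {0..1::real}"
  note s = tendsto_diff_at_within[of t0 "{0..1}"]
  define g where "g t = (v t - (v0 + (t - t0) *\<^sub>R v1 + ((t - t0)\<^sup>2 / 2) *\<^sub>R v2)) /\<^sub>R (t - t0)\<^sup>2" for t
  have g: "(g \<longlongrightarrow> 0) ?F" using assms by (simp add: has_expansion2_def g_def[abs_def])
  have lim: "((\<lambda>t. (t - t0) *\<^sub>R g t + ((t - t0) / 2) *\<^sub>R v2) \<longlongrightarrow> 0) ?F"
    by (rule tendsto_eq_intros s g refl | simp)+
  have eq: "(t - t0) *\<^sub>R g t + ((t - t0) / 2) *\<^sub>R v2 = ((t - t0) *\<^sub>R v t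
      - (0 + (t - t0) *\<^sub>R v0 + ((t - t0)\<^sup>2 / 2) *\<^sub>R 2 *\<^sub>R v1)) /\<^sub>R (t - t0)\<^sup>2"
    if "t \<noteq> t0" for t
  proof -
    have "(t - t0)\<^sup>2 *\<^sub>R ((t - t0) *\<^sub>R g t + ((t - t0) / 2) *\<^sub>R v2)
        = (t - t0) *\<^sub>R ((t - t0)\<^sup>2 *\<^sub>R g t) + ((t - t0) * ((t - t0)\<^sup>2 / 2)) *\<^sub>R v2"
      by (simp add: scaleR_add_right mult.commute)
    also have "(t - t0)\<^sup>2 *\<^sub>R g t = v t - (v0 + (t - t0) *\<^sub>R v1 + ((t - t0)\<^sup>2 / 2) *\<^sub>R v2)"
      using that by (simp add: g_def)
    also have "(t - t0) *\<^sub>R (v t - (v0 + (t - t0) *\<^sub>R v1 + ((t - t0)\<^sup>2 / 2) *\<^sub>R v2))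
        + ((t - t0) * ((t - t0)\<^sup>2 / 2)) *\<^sub>R v2
        = (t - t0) *\<^sub>R v t - (0 + (t - t0) *\<^sub>R v0 + ((t - t0)\<^sup>2 / 2) *\<^sub>R 2 *\<^sub>R v1)"
      by (simp add: scaleR_add_right scaleR_diff_right power2_eq_square)
    finally have *: "(t - t0)\<^sup>2 *\<^sub>R ((t - t0) *\<^sub>R g t + ((t - t0) / 2) *\<^sub>R v2)
        = (t - t0) *\<^sub>R v t - (0 + (t - t0) *\<^sub>R v0 + ((t - t0)\<^sup>2 / 2) *\<^sub>R 2 *\<^sub>R v1)" .
    show ?thesis unfolding *[symmetric] using that by simp
  qed
  show ?thesis
    unfolding has_expansion2_def
    by (rule tendsto_cong[THEN iffD1, OF _ lim])
      (use eq in \<open>auto intro: eventually_mono[OF eventually_unit_interval]\<close>)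
qed

text \<open>The product rule. The remainder of \<open>F\<close> is small in operator norm, hence also on the convergent,
  moving argument \<open>v t\<close>; the other three terms have expansions by linearity and by
  \<open>has_expansion2_shift\<close>.\<close>

lemma has_expansion2_apply:
  fixes F :: "real \<Rightarrow> 'a::complex_hilbert \<Rightarrow> 'b::complex_hilbert"
  assumes F: "\<And>t. t \<in> {0..1} \<Longrightarrow> bounded_clinear (F t)" and t0: "t0 \<in> {0..1}"
    and F12: "bounded_clinear F1" "bounded_clinear F2" and exp: "expansion2 F F1 F2 t0"
    and v: "has_expansion2 v v0 v1 v2 t0"
  shows "has_expansion2 (\<lambda>t. F t (v t)) (F t0 v0) (F t0 v1 + F1 v0)
    (F t0 v2 + 2 *\<^sub>R F1 v1 + F2 v0) t0"
proof -
  let ?N = "at t0 within {0..1::real}"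
  define E where "E t x = F t x - (F t0 x + (t - t0) *\<^sub>R F1 x + ((t - t0)\<^sup>2 / 2) *\<^sub>R F2 x)" for t x
  have "((\<lambda>t. onorm (E t) / (t - t0)\<^sup>2) \<longlongrightarrow> 0) ?N"
    using exp unfolding expansion2_def E_def[abs_def] by (rule smalloD_tendsto)
  then have lim: "((\<lambda>t. onorm (E t) / (t - t0)\<^sup>2 * norm (v t)) \<longlongrightarrow> 0 * norm v0) ?N"
    by (intro tendsto_mult tendsto_norm has_expansion2_tendsto[OF v])
  have "norm (E t (v t) /\<^sub>R (t - t0)\<^sup>2) \<le> onorm (E t) / (t - t0)\<^sup>2 * norm (v t)"
    if "t \<in> {0..1}" for t
  proof -
    have "bounded_linear (E t)"
      unfolding E_def[abs_def] using F[OF that] F[OF t0] F12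
      by (intro bounded_linear_sub bounded_linear_add
          bounded_linear_compose[OF bounded_linear_scaleR_right] bounded_clinear_bounded_linear)
    from mult_left_mono[OF onorm[OF this, of "v t"], of "inverse ((t - t0)\<^sup>2)"]
    show ?thesis by (simp add: divide_inverse mult.assoc mult.left_commute)
  qed
  then have "\<forall>\<^sub>F t in ?N. norm (E t (v t) /\<^sub>R (t - t0)\<^sup>2) \<le> onorm (E t) / (t - t0)\<^sup>2 * norm (v t)"
    using eventually_unit_interval[of t0] by (auto elim: eventually_mono)
  then have "((\<lambda>t. E t (v t) /\<^sub>R (t - t0)\<^sup>2) \<longlongrightarrow> 0) ?N"
    by (rule Lim_null_comparison) (use lim in simp)
  then have r: "has_expansion2 (\<lambda>t. E t (v t)) 0 0 0 t0"
    by (simp add: has_expansion2_def)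
  note lin = has_expansion2_linear[OF bounded_clinear_bounded_linear v]
  have 0: "has_expansion2 (\<lambda>t. F t0 (v t)) (F t0 v0) (F t0 v1) (F t0 v2) t0"
    by (rule lin[OF F[OF t0]])
  have 1: "has_expansion2 (\<lambda>t. (t - t0) *\<^sub>R F1 (v t)) 0 (F1 v0) (2 *\<^sub>R F1 v1) t0"
    by (rule has_expansion2_shift[OF lin[OF F12(1)]])
  have "has_expansion2 (\<lambda>t. (1/2) *\<^sub>R (t - t0) *\<^sub>R (t - t0) *\<^sub>R F2 (v t))
      ((1/2) *\<^sub>R 0) ((1/2) *\<^sub>R 0) ((1/2) *\<^sub>R 2 *\<^sub>R F2 v0) t0"
    by (rule has_expansion2_linear[OF bounded_linear_scaleR_right
          has_expansion2_shift[OF has_expansion2_shift[OF lin[OF F12(2)]]]])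
  then have 2: "has_expansion2 (\<lambda>t. ((t - t0)\<^sup>2 / 2) *\<^sub>R F2 (v t)) 0 0 (F2 v0) t0"
    by (simp add: power2_eq_square)
  have "has_expansion2 (\<lambda>t. E t (v t) + (F t0 (v t) + (t - t0) *\<^sub>R F1 (v t) + ((t - t0)\<^sup>2 / 2) *\<^sub>R F2 (v t)))
      (0 + (F t0 v0 + 0 + 0)) (0 + (F t0 v1 + F1 v0 + 0)) (0 + (F t0 v2 + 2 *\<^sub>R F1 v1 + F2 v0)) t0"
    by (intro has_expansion2_add r 0 1 2)
  then show ?thesis by (simp add: E_def)
qed

lemma has_expansion2_apply_const:
  assumes "\<And>t. t \<in> {0..1} \<Longrightarrow> bounded_clinear (F t)" "t0 \<in> {0..1}"
    and "bounded_clinear F1" "bounded_clinear F2" "expansion2 F F1 F2 t0"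
  shows "has_expansion2 (\<lambda>t. F t x) (F t0 x) (F1 x) (F2 x) t0"
  using has_expansion2_apply[OF assms has_expansion2_const[of x]]
    bounded_clinear_zero[OF assms(1)[OF assms(2)]] bounded_clinear_zero[OF assms(3)]
  by simp

section \<open>Differentiating the Lagrangian subspaces\<close>

context lagrangian_family
begin

lemma Q_bounded: "t \<in> {0..1} \<Longrightarrow> bounded_clinear (Q t)"
  using Q_proj by (simp add: orthogonal_projection_def)

lemma Q_fixed:
  assumes "t \<in> {0..1}" "f \<in> range (Q t)"
  shows "Q t f = f"
proof -
  have "Q t \<circ> Q t = Q t" using Q_proj[OF assms(1)] by (simp add: orthogonal_projection_def)
  then have "Q t (Q t g) = Q t g" for g by (metis o_apply)
  then show ?thesis using assms(2) by auto
qed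

lemma Q_symmetric: "t \<in> {0..1} \<Longrightarrow> cinner (Q t f) g = cinner f (Q t g)"
  using cinner_cadjoint[of "Q t" f g] Q_proj[of t] by (simp add: orthogonal_projection_def)

text \<open>\<open>Jop\<close> maps a Lagrangian subspace onto its orthogonal complement.\<close>

lemma Q_Jop:
  assumes t: "t \<in> {0..1}"
  shows "Q t (Jop f) = Jop f - Jop (Q t f)"
proof -
  have "Q t (Jop (Q t f)) = 0"
  proof (rule cinner_ext)
    fix g
    have "symplectic_form (Q t f) (Q t g) = 0" using lagrangian_mem_iff[OF t, of "Q t f"] by blast
    then show "cinner (Q t (Jop (Q t f))) g = cinner 0 g"
      by (simp add: Q_symmetric[OF t] symplectic_form_Jop)
  qed
  moreover have "Q t (Jop (f - Q t f)) = Jop (f - Q t f)"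
  proof (rule Q_fixed[OF t])
    have "symplectic_form (Jop (f - Q t f)) g = 0" if "g \<in> range (Q t)" for g
    proof -
      have "cinner (f - Q t f) g = cinner f g - cinner f (Q t g)"
        by (simp add: cinner_simps Q_symmetric[OF t])
      then show ?thesis
        using Q_fixed[OF t that] unfolding symplectic_form_Jop Jop_Jop cinner_minus_left by simp
    qed
    then show "Jop (f - Q t f) \<in> range (Q t)" using lagrangian_mem_iff[OF t] by blast
  qed
  ultimately show ?thesis
    by (simp add: bounded_clinear_diff[OF Q_bounded[OF t]] bounded_clinear_diff[OF bounded_clinear_Jop])
qed

lemma Q_expansion2: "has_expansion2 (\<lambda>t. Q t f) (Q t0 f) (Q1 f) (Q2 f) t0"
  by (rule has_expansion2_apply_const[OF Q_bounded t0 Q12_bounded Q_expansion])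

lemma Q1_Jop: "Q1 (Jop f) = - Jop (Q1 f)"
proof -
  have "has_expansion2 (\<lambda>t. Jop f - Jop (Q t f)) (Jop f - Jop (Q t0 f)) (0 - Jop (Q1 f)) (0 - Jop (Q2 f)) t0"
    by (intro has_expansion2_diff has_expansion2_const
        has_expansion2_linear[OF bounded_clinear_bounded_linear[OF bounded_clinear_Jop]] Q_expansion2)
  from has_expansion2_unique(2)[OF t0 Q_expansion2 this Q_Jop] show ?thesis by simp
qed

end

locale robin_family = lagrangian_family A \<Gamma>0 \<Gamma>1 Q Q1 Q2 t0 lam m
  for A :: "('h::complex_hilbert \<times> 'h) set"
    and \<Gamma>0 \<Gamma>1 :: "'h \<Rightarrow> 'k::complex_hilbert"
    and Q :: "real \<Rightarrow> 'k \<times> 'k \<Rightarrow> 'k \<times> 'k"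
    and Q1 Q2 :: "'k \<times> 'k \<Rightarrow> 'k \<times> 'k"
    and t0 :: real and lam :: complex and m :: nat +
  fixes \<Theta> :: "real \<Rightarrow> 'k \<Rightarrow> 'k" and \<Theta>1 \<Theta>2 :: "'k \<Rightarrow> 'k"
  assumes \<Theta>_selfadjoint: "\<And>t. t \<in> {0..1} \<Longrightarrow> bounded_clinear (\<Theta> t) \<and> cadjoint (\<Theta> t) = \<Theta> t"
    and ran_Q: "\<And>t. t \<in> {0..1} \<Longrightarrow> range (Q t) = {(f, g). \<Theta> t f - g = 0}"
    and \<Theta>12_bounded: "bounded_clinear \<Theta>1" "bounded_clinear \<Theta>2"
    and \<Theta>_expansion: "expansion2 \<Theta> \<Theta>1 \<Theta>2 t0"
begin

lemma \<Theta>_bounded: "t \<in> {0..1} \<Longrightarrow> bounded_clinear (\<Theta> t)"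
  using \<Theta>_selfadjoint by blast

lemma \<Theta>_symmetric: "t \<in> {0..1} \<Longrightarrow> cinner (\<Theta> t x) y = cinner x (\<Theta> t y)"
  using \<Theta>_selfadjoint[of t] cinner_cadjoint[of "\<Theta> t" x y] by simp

lemma mem_range_Q: "t \<in> {0..1} \<Longrightarrow> f \<in> range (Q t) \<longleftrightarrow> snd f = \<Theta> t (fst f)"
  using ran_Q[of t] by (cases f) auto

lemma \<Theta>1_symmetric: "cinner (\<Theta>1 x) y = cinner x (\<Theta>1 y)"
proof -
  note exp = has_expansion2_apply_const[OF \<Theta>_bounded t0 \<Theta>12_bounded \<Theta>_expansion]
  show ?thesis
    by (rule has_expansion2_unique(2)[OF t0
          has_expansion2_linear[OF bounded_linear_cinner_left exp]
          has_expansion2_linear[OF bounded_linear_cinner_right exp] \<Theta>_symmetric])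
qed

text \<open>The range condition \<open>snd (Q t f) = \<Theta> t (fst (Q t f))\<close>, differentiated once and twice.\<close>

lemma snd_Q1: "snd (Q1 f) = \<Theta> t0 (fst (Q1 f)) + \<Theta>1 (fst (Q t0 f))"
  and snd_Q2: "snd (Q2 f) = \<Theta> t0 (fst (Q2 f)) + 2 *\<^sub>R \<Theta>1 (fst (Q1 f)) + \<Theta>2 (fst (Q t0 f))"
proof -
  have "snd (Q t f) = \<Theta> t (fst (Q t f))" if "t \<in> {0..1}" for t
    using mem_range_Q[OF that] by blast
  note unique = has_expansion2_unique(2,3)[OF t0
      has_expansion2_linear[OF bounded_linear_snd Q_expansion2]
      has_expansion2_apply[OF \<Theta>_bounded t0 \<Theta>12_bounded \<Theta>_expansion
        has_expansion2_linear[OF bounded_linear_fst Q_expansion2]] this]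
  show "snd (Q1 f) = \<Theta> t0 (fst (Q1 f)) + \<Theta>1 (fst (Q t0 f))"
    and "snd (Q2 f) = \<Theta> t0 (fst (Q2 f)) + 2 *\<^sub>R \<Theta>1 (fst (Q1 f)) + \<Theta>2 (fst (Q t0 f))"
    by (rule unique; assumption)+
qed

text \<open>\<open>\<langle>Jop g, f\<rangle>\<close> for \<open>f\<close> in the graph of \<open>\<Theta>\<close> sees only the deviation of \<open>g\<close> from the graph.\<close>

lemma cinner_Jop_graph:
  assumes f: "f \<in> range (Q t0)"
  shows "cinner (Jop g) f = cinner (snd g - \<Theta> t0 (fst g)) (fst f)"
  using mem_range_Q[OF t0, of f] f
  by (simp add: Jop_def cinner_prod_def cinner_simps \<Theta>_symmetric[OF t0])

lemma first_coefficient: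
  assumes f: "f \<in> range (Q t0)"
  shows "cinner (Jop (Q1 f)) f = cinner (\<Theta>1 (fst f)) (fst f)"
  by (simp add: cinner_Jop_graph[OF f] snd_Q1 Q_fixed[OF t0 f])

lemma cadjoint_\<Gamma>0_S: "cadjoint (\<Gamma>0 \<circ> S) c = cadjoint (T \<circ> S) (c, 0)"
proof (rule cadjoint_eqI)
  have "bounded_clinear fst"
    by (auto simp: bounded_clinear_def scaleC_prod_def bounded_linear_fst)
  from bounded_clinear_compose[OF this bounded_clinear_TS]
  show "bounded_clinear (\<Gamma>0 \<circ> S)" by (simp add: o_def trace_map_def)
  show "cinner ((\<Gamma>0 \<circ> S) x) c = cinner x (cadjoint (T \<circ> S) (c, 0))" for x
    by (simp add: cinner_cadjoint[OF bounded_clinear_TS, symmetric] cinner_prod_def trace_map_def)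
qed

text \<open>Let \<open>a = fst f\<close>. As \<open>Q1\<close> anticommutes with \<open>Jop\<close> and \<open>Jop f\<close> is orthogonal to the range of
  \<open>Q t0\<close>, one has \<open>Q1 (Jop f) = (b, \<Theta> b)\<close> and \<open>Q1 f = (\<Theta> b, - b)\<close> for some \<open>b\<close>, and then
  \<open>b + \<Theta> (\<Theta> b) = - \<Theta>1 a\<close>. Consequently \<open>(T S)\<^sup>* Q1 Jop f = - (\<Gamma>0 S)\<^sup>* \<Theta>1 a\<close>, because the range of
  \<open>T S\<close> consists of pairs \<open>(e, \<Theta> e)\<close>; the two occurrences of \<open>\<Theta>1 (\<Theta> b)\<close>, one from \<open>Q2\<close> and one from
  the boundary values of \<open>(\<Gamma>0 S)\<^sup>* \<Theta>1 a\<close>, cancel.\<close>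

lemma second_coefficient:
  assumes f: "f \<in> range (Q t0)"
  shows "cinner (Jop (Q2 f)) f - 2 * cinner (Q1 (Jop f)) (T (cadjoint (T \<circ> S) (Q1 (Jop f))))
    = cinner (\<Theta>2 (fst f) - 2 *\<^sub>C \<Theta>1 (\<Gamma>0 (cadjoint (\<Gamma>0 \<circ> S) (\<Theta>1 (fst f))))) (fst f)"
proof -
  define a b c w where "a = fst f" and "b = fst (Q1 (Jop f))" and "c = \<Theta>1 a"
    and "w = cadjoint (T \<circ> S) (c, 0)"
  note \<Theta>_lin = \<Theta>_bounded[OF t0]
  have "Q t0 (Jop f) = 0" by (simp add: Q_Jop[OF t0] Q_fixed[OF t0 f])
  then have QJ: "Q1 (Jop f) = (b, \<Theta> t0 b)"
    using snd_Q1[of "Jop f"] by (simp add: b_def prod_eq_iff bounded_clinear_zero[OF \<Theta>12_bounded(1)])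
  have "Q1 f = Jop (Q1 (Jop f))"
    by (simp add: Q1_Jop bounded_clinear_minus[OF bounded_clinear_Jop] Jop_Jop)
  then have "Q1 f = Jop (b, \<Theta> t0 b)" by (simp only: QJ)
  then have Qf: "Q1 f = (\<Theta> t0 b, - b)" by (simp add: Jop_def)
  have b: "b + \<Theta> t0 (\<Theta> t0 b) = - c"
    using snd_Q1[of f] by (simp add: Qf Q_fixed[OF t0 f] a_def c_def neg_eq_iff_add_eq_0 eq_neg_iff_add_eq_0 ac_simps)
  have J2: "cinner (Jop (Q2 f)) f = 2 * cinner (\<Theta>1 (\<Theta> t0 b)) a + cinner (\<Theta>2 a) a"
    by (simp add: cinner_Jop_graph[OF f] snd_Q2 Q_fixed[OF t0 f] Qf a_def cinner_simps)
  have "cadjoint (T \<circ> S) (Q1 (Jop f)) = (-1) *\<^sub>C w"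
  proof (rule cadjoint_eqI[OF bounded_clinear_TS])
    fix x
    have "T (S x) \<in> range (Q t0)" using S_mem[of x] by (simp add: ext_iff)
    then have "T (S x) = (\<Gamma>0 (S x), \<Theta> t0 (\<Gamma>0 (S x)))"
      using mem_range_Q[OF t0, of "T (S x)"] by (simp add: trace_map_def)
    then have "cinner (T (S x)) (Q1 (Jop f)) = cinner (\<Gamma>0 (S x)) (b + \<Theta> t0 (\<Theta> t0 b))"
      by (simp add: QJ cinner_prod_def cinner_simps \<Theta>_symmetric[OF t0])
    also have "\<dots> = cinner x ((-1) *\<^sub>C w)"
      by (simp add: b w_def cinner_simps cinner_cadjoint[OF bounded_clinear_TS, symmetric]
          cinner_prod_def trace_map_def)
    finally show "cinner ((T \<circ> S) x) (Q1 (Jop f)) = cinner x ((-1) *\<^sub>C w)" by simp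
  qed
  then have Tw: "T (cadjoint (T \<circ> S) (Q1 (Jop f))) = (-1) *\<^sub>C T w"
    using trace_scale[OF cadjoint_TS_mem, of "-1" "(c, 0)"] by (simp add: w_def)
  have G1: "\<Gamma>1 w = \<Theta> t0 (\<Gamma>0 w) - c"
  proof (rule cinner_ext)
    fix e
    have e: "(e, \<Theta> t0 e) \<in> range (Q t0)" by (simp add: mem_range_Q[OF t0])
    from boundary_value_cadjoint_TS[OF e, of "(c, 0)"]
    show "cinner (\<Gamma>1 w) e = cinner (\<Theta> t0 (\<Gamma>0 w) - c) e"
      by (simp add: Jop_def w_def[symmetric] cinner_simps cinner_prod_def trace_map_def
          \<Theta>_symmetric[OF t0] algebra_simps)
  qed
  have sym: "cinner c (\<Gamma>0 w) = cinner (\<Gamma>0 w) c"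
    using cadjoint_TS_isotropic[of "(c, 0)"]
    by (simp add: w_def[symmetric] symplectic_form_def trace_map_def G1 cinner_simps \<Theta>_symmetric[OF t0])
  have "cinner (Q1 (Jop f)) (T w) = cinner b (\<Gamma>0 w) + cinner (\<Theta> t0 b) (\<Theta> t0 (\<Gamma>0 w) - c)"
    by (simp add: QJ trace_map_def G1 cinner_prod_def)
  also have "\<dots> = cinner (b + \<Theta> t0 (\<Theta> t0 b)) (\<Gamma>0 w) - cinner (\<Theta>1 (\<Theta> t0 b)) a"
    by (simp add: cinner_simps \<Theta>_symmetric[OF t0] \<Theta>1_symmetric c_def)
  also have "\<dots> = - cinner (\<Theta>1 (\<Gamma>0 w)) a - cinner (\<Theta>1 (\<Theta> t0 b)) a"
    unfolding b cinner_minus_left sym by (simp add: \<Theta>1_symmetric c_def)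
  finally show ?thesis
    by (simp add: J2 Tw cadjoint_\<Gamma>0_S cinner_simps flip: a_def c_def w_def)
qed

end

theorem corollary2p12:
  fixes A :: "('h::complex_hilbert \<times> 'h) set"
    and \<Gamma>0 \<Gamma>1 :: "'h \<Rightarrow> 'k::complex_hilbert"
    and Q :: "real \<Rightarrow> 'k \<times> 'k \<Rightarrow> 'k \<times> 'k"
    and Q1 Q2 :: "'k \<times> 'k \<Rightarrow> 'k \<times> 'k"
    and \<Theta> :: "real \<Rightarrow> 'k \<Rightarrow> 'k"
    and \<Theta>1 \<Theta>2 :: "'k \<Rightarrow> 'k"
    and t0 :: real and lam :: complex and m m' :: nat and mi :: "nat \<Rightarrow> nat"
    and \<mu> :: "nat \<Rightarrow> complex" and \<nu> :: "nat \<Rightarrow> nat \<Rightarrow> complex"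
    and curve :: "nat \<Rightarrow> nat \<Rightarrow> real \<Rightarrow> complex"
    and u :: "nat \<Rightarrow> nat \<Rightarrow> 'h"
    and S :: "'h \<Rightarrow> 'h"
  assumes context_data: "eigenvalue_curves A \<Gamma>0 \<Gamma>1 Q Q1 Q2 t0 lam m m' mi \<mu> \<nu> curve u"
    and S: "S = lagrangian_family.S A \<Gamma>0 \<Gamma>1 Q t0 lam"
    and \<Theta>_selfadjoint: "\<And>t. t \<in> {0..1} \<Longrightarrow> bounded_clinear (\<Theta> t) \<and> cadjoint (\<Theta> t) = \<Theta> t"
    and ran_Q: "\<And>t. t \<in> {0..1} \<Longrightarrow> range (Q t) = {(f, g). \<Theta> t f - g = 0}"
    and \<Theta>12_bounded: "bounded_clinear \<Theta>1" "bounded_clinear \<Theta>2"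
    and \<Theta>_expansion: "expansion2 \<Theta> \<Theta>1 \<Theta>2 t0"
    and i: "i \<in> {1..m'}" and k: "k \<in> {1..mi i}"
  shows "(\<lambda>t. curve i k t -
            (lam + cinner (\<Theta>1 (\<Gamma>0 (u i k))) (\<Gamma>0 (u i k)) * of_real (t - t0)
              + 1/2 * cinner (\<Theta>2 (\<Gamma>0 (u i k))
                               - 2 *\<^sub>C \<Theta>1 (\<Gamma>0 (cadjoint (\<Gamma>0 \<circ> S) (\<Theta>1 (\<Gamma>0 (u i k))))))
                             (\<Gamma>0 (u i k)) * of_real ((t - t0)\<^sup>2)))
          \<in> o[at t0 within {0..1}](\<lambda>t. of_real ((t - t0)\<^sup>2))"
proof -
  interpret eigenvalue_curves A \<Gamma>0 \<Gamma>1 Q Q1 Q2 t0 lam m m' mi \<mu> \<nu> curve u by (rule context_data)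
  interpret R: robin_family A \<Gamma>0 \<Gamma>1 Q Q1 Q2 t0 lam m \<Theta> \<Theta>1 \<Theta>2
    by unfold_locales (use \<Theta>_selfadjoint ran_Q \<Theta>12_bounded \<Theta>_expansion in auto)
  note coeff = curve_coefficients[OF i k]
  have "\<mu> i = cinner (\<Theta>1 (\<Gamma>0 (u i k))) (\<Gamma>0 (u i k))"
    using coeff(2) R.first_coefficient[OF coeff(1)] by (simp add: trace_map_def)
  moreover have "\<nu> i k = cinner (\<Theta>2 (\<Gamma>0 (u i k))
      - 2 *\<^sub>C \<Theta>1 (\<Gamma>0 (cadjoint (\<Gamma>0 \<circ> S) (\<Theta>1 (\<Gamma>0 (u i k)))))) (\<Gamma>0 (u i k))"
    using coeff(3) R.second_coefficient[OF coeff(1)] by (simp add: trace_map_def S)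
  ultimately show ?thesis
    using curve_expansion[OF i k] by simp
qed

end
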